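(* Let $\mathcal{C}$ be a half-line CMV matrix and let $\mu$ be its spectral measure. For $n\ge0$ let $d\mu_n(\theta)=|\varphi_n(e^{i\theta})|^2\,d\mu(\theta)$ be the spectral measure of $\mathcal{C}$ and $\delta_n$. If for some $c\in\overline{\mathbb{D}}\setminus\{0\}$ and $k\in\mathbb{N}\cup\{\infty\}$, $$\lim_{n\to\infty}\int_0^{2\pi}e^{i\ell\theta}\,d\mu_n(\theta)=\begin{cases}0,&\ell=1,\dots,k-1,\\ c,&\ell=k,\ k<\infty,\end{cases}$$ (for $k=\infty$: the limit is $0$ for every $\ell\in\mathbb{N}$), then all right limits of $\mathcal{C}$ are in $\mathcal{K}(c,k)$ if $k<\infty$, or in $\mathcal{K}(\infty)$ if $k=\infty$.
   Context: $\mathbb{N}=\{1,2,\dots\}$ and $\mathbb{D}$ is the open unit disc. A probability measure $\mu$ on $\partial\mathbb{D}$ with infinite support has monic orthogonal polynomials $\Phi_n$ (orthonormal versions $\varphi_n$) satisfying $\Phi_{n+1}(z)=z\Phi_n(z)-\overline{\alpha_n}\,\Phi_n^*(z)$, $\Phi_n^*(z)=z^n\overline{\Phi_n(1/\bar z)}$; the numbers $\alpha_n\in\mathbb{D}$ are its Verblunsky coefficients, and $\mu\leftrightarrow\{\alpha_n\}_{n\ge0}\in\mathbb{D}^{\mathbb{Z}_+}$ is a bijection. The half-line CMV matrix of $\{\alpha_n\}_{n\ge 0}$ is the unitary operator on $\ell^2(\mathbb{Z}_+)$ given by $\mathcal{C}=\mathcal{L}\mathcal{M}$, $\mathcal{L}=\Theta_0\oplus\Theta_2\oplus\cdots$,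 $\mathcal{M}=(1)\oplus\Theta_1\oplus\Theta_3\oplus\cdots$, $\Theta_k=\begin{pmatrix}\bar\alpha_k&\rho_k\\ \rho_k&-\alpha_k\end{pmatrix}$, $\rho_k=(1-|\alpha_k|^2)^{1/2}$; $\mu$ is its spectral measure. For $\{\widetilde\alpha_n\}_{n\in\mathbb{Z}}$ with $|\widetilde\alpha_n|\le1$, the whole-line CMV matrix is the unitary operator $\mathcal{E}=\mathcal{L}\mathcal{M}$ on $\ell^2(\mathbb{Z})$, with $\mathcal{L}$ the direct sum over $k\in\mathbb{Z}$ of blocks $\Theta_{2k}$ acting on coordinates $2k,2k+1$ and $\mathcal{M}$ the direct sum of blocks $\Theta_{2k-1}$ acting on coordinates $2k-1,2k$ (with $\Theta_k$ formed from $\widetilde\alpha_k$). $\mathcal{E}$ is a right limit of $\mathcal{C}$ if there are integers $n_j\to\infty$ with $\widetilde\alpha_n=\lim_{j\to\infty}\alpha_{n+n_j}$ for every $n\in\mathbb{Z}$. A whole-line CMV matrix $\mathcal{E}$ belongs to Khrushchev Class if the spectral measures of $\mathcal{E}$ and $\delta_n$ are the same for all $n\in\mathbb{Z}$. For $k<\infty$, $\mathcal{K}(c,k)$ is the set of matrices $\mathcal{E}$ in the Khrushchev Class with $[\mathcal{E}^\ell]_{n,n}=0$ for all $n\in\mathbb{Z}$, $\ell=1,\dots,k-1$, and $[\mathcal{E}^k]_{n,n}=c\ne0$ for all $n\in\mathbb{Z}$. $\mathcal{K}(\infty)$ is the set of whole-line CMV matrices with $[\mathcal{E}^\ell]_{n,n}=0$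 for all $n\in\mathbb{Z}$, $\ell\ge1$. *)

theory Defs
  imports "HOL-Analysis.Analysis" "HOL-Computational_Algebra.Polynomial" "HOL-Library.Extended_Nat"
begin

section \<open>Inner product, matrix entries and spectral measures\<close>

definition l2_inner :: "('i \<Rightarrow> complex) \<Rightarrow> ('i \<Rightarrow> complex) \<Rightarrow> complex" where
  "l2_inner x y = (\<Sum>\<^sub>\<infinity>i. cnj (x i) * y i)"

definition delta :: "'i \<Rightarrow> 'i \<Rightarrow> complex" where
  "delta n = (\<lambda>i. if i = n then 1 else 0)"

definition entry :: "(('i \<Rightarrow> complex) \<Rightarrow> ('i \<Rightarrow> complex)) \<Rightarrow> 'i \<Rightarrow> 'i \<Rightarrow> complex" where
  "entry A m n = l2_inner (delta m) (A (delta n))"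

text \<open>
  \<open>nu\<close> is the spectral measure of the unitary operator \<open>U\<close> and the vector \<open>v\<close>: the positive
  Borel measure on the unit circle (a Borel measure on the complex plane that gives no mass to the
  complement of the circle) whose moments are \<open>\<langle>v, U^l v\<rangle>\<close>. It suffices to list \<open>l \<ge> 0\<close>: for unitary
  \<open>U\<close> both sides at \<open>-l\<close> are the complex conjugates of those at \<open>l\<close>.
\<close>

definition spectral_measure ::
  "(('i \<Rightarrow> complex) \<Rightarrow> ('i \<Rightarrow> complex)) \<Rightarrow> ('i \<Rightarrow> complex) \<Rightarrow> complex measure \<Rightarrow> bool" where
  "spectral_measure U v nu \<longleftrightarrow>
     finite_measure nu \<and> sets nu = sets borel \<and> emeasure nu (- sphere 0 1) = 0 \<and>
     (\<forall>l::nat. (\<integral>z. z ^ l \<partial>nu) = l2_inner v ((U ^^ l) v))"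

section \<open>CMV matrices\<close>

text \<open>
  The matrices below are banded, hence act by the same formulas on all sequences; the unitary
  operators of the theory are the restrictions to \<open>\<ell>\<^sup>2\<close>.
\<close>

definition rho :: "complex \<Rightarrow> complex" where
  "rho a = complex_of_real (sqrt (1 - (cmod a)\<^sup>2))"

fun Theta :: "complex \<Rightarrow> complex \<times> complex \<Rightarrow> complex \<times> complex" where
  "Theta a (x, y) = (cnj a * x + rho a * y, rho a * x - a * y)"

definition half_L :: "(nat \<Rightarrow> complex) \<Rightarrow> (nat \<Rightarrow> complex) \<Rightarrow> (nat \<Rightarrow> complex)" where
  "half_L \<alpha> x = (\<lambda>n. if even n then fst (Theta (\<alpha> n) (x n, x (n + 1)))
                      else snd (Theta (\<alpha> (n - 1)) (x (n - 1), x n)))"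

definition half_M :: "(nat \<Rightarrow> complex) \<Rightarrow> (nat \<Rightarrow> complex) \<Rightarrow> (nat \<Rightarrow> complex)" where
  "half_M \<alpha> x = (\<lambda>n. if n = 0 then x 0
                      else if odd n then fst (Theta (\<alpha> n) (x n, x (n + 1)))
                      else snd (Theta (\<alpha> (n - 1)) (x (n - 1), x n)))"

definition half_CMV :: "(nat \<Rightarrow> complex) \<Rightarrow> (nat \<Rightarrow> complex) \<Rightarrow> (nat \<Rightarrow> complex)" where
  "half_CMV \<alpha> = half_L \<alpha> \<circ> half_M \<alpha>"

definition whole_L :: "(int \<Rightarrow> complex) \<Rightarrow> (int \<Rightarrow> complex) \<Rightarrow> (int \<Rightarrow> complex)" where
  "whole_L \<alpha> x = (\<lambda>n. if even n then fst (Theta (\<alpha> n) (x n, x (n + 1)))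
                       else snd (Theta (\<alpha> (n - 1)) (x (n - 1), x n)))"

definition whole_M :: "(int \<Rightarrow> complex) \<Rightarrow> (int \<Rightarrow> complex) \<Rightarrow> (int \<Rightarrow> complex)" where
  "whole_M \<alpha> x = (\<lambda>n. if odd n then fst (Theta (\<alpha> n) (x n, x (n + 1)))
                       else snd (Theta (\<alpha> (n - 1)) (x (n - 1), x n)))"

definition whole_CMV :: "(int \<Rightarrow> complex) \<Rightarrow> (int \<Rightarrow> complex) \<Rightarrow> (int \<Rightarrow> complex)" where
  "whole_CMV \<alpha> = whole_L \<alpha> \<circ> whole_M \<alpha>"

definition whole_line_CMV :: "((int \<Rightarrow> complex) \<Rightarrow> (int \<Rightarrow> complex)) set" where
  "whole_line_CMV = {whole_CMV \<alpha> | \<alpha>. \<forall>n. cmod (\<alpha> n) \<le> 1}"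

text \<open>
  \<open>right_limits \<alpha>\<close> are the right limits of \<open>half_CMV \<alpha>\<close>. For fixed \<open>n\<close> the index \<open>n + s j\<close> is
  nonnegative for all large \<open>j\<close>, so the truncation in \<open>nat\<close> does not affect the limit.
\<close>

definition right_limits :: "(nat \<Rightarrow> complex) \<Rightarrow> ((int \<Rightarrow> complex) \<Rightarrow> (int \<Rightarrow> complex)) set" where
  "right_limits \<alpha> = {whole_CMV \<beta> | \<beta>. (\<forall>n. cmod (\<beta> n) \<le> 1) \<and>
     (\<exists>s :: nat \<Rightarrow> int. filterlim s at_top sequentially \<and>
        (\<forall>n. (\<lambda>j. \<alpha> (nat (n + s j))) \<longlonglongrightarrow> \<beta> n))}"

section \<open>Orthogonal polynomials on the unit circle\<close>

definition monic_OP :: "complex measure \<Rightarrow> nat \<Rightarrow> complex poly" where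
  "monic_OP \<mu> n = (THE p. degree p = n \<and> lead_coeff p = 1 \<and>
     (\<forall>m<n. (\<integral>z. cnj (z ^ m) * poly p z \<partial>\<mu>) = 0))"

definition orthonormal_OP :: "complex measure \<Rightarrow> nat \<Rightarrow> complex poly" where
  "orthonormal_OP \<mu> n =
     smult (complex_of_real (1 / sqrt (\<integral>z. (cmod (poly (monic_OP \<mu> n) z))\<^sup>2 \<partial>\<mu>))) (monic_OP \<mu> n)"

definition OP_measure :: "complex measure \<Rightarrow> nat \<Rightarrow> complex measure" where
  "OP_measure \<mu> n = density \<mu> (\<lambda>z. ennreal ((cmod (poly (orthonormal_OP \<mu> n) z))\<^sup>2))"

section \<open>The Khrushchev class\<close>

definition Khrushchev_class :: "((int \<Rightarrow> complex) \<Rightarrow> (int \<Rightarrow> complex)) set" where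
  "Khrushchev_class = {E \<in> whole_line_CMV. \<exists>nu. \<forall>n. spectral_measure E (delta n) nu}"

definition K_fin :: "complex \<Rightarrow> nat \<Rightarrow> ((int \<Rightarrow> complex) \<Rightarrow> (int \<Rightarrow> complex)) set" where
  "K_fin c k = {E \<in> Khrushchev_class. c \<noteq> 0 \<and>
     (\<forall>n. \<forall>l\<in>{1..<k}. entry (E ^^ l) n n = 0) \<and> (\<forall>n. entry (E ^^ k) n n = c)}"

definition K_inf :: "((int \<Rightarrow> complex) \<Rightarrow> (int \<Rightarrow> complex)) set" where
  "K_inf = {E \<in> whole_line_CMV. \<forall>n. \<forall>l\<ge>1. entry (E ^^ l) n n = 0}"

end

theory Submission
  imports Defs "HOL-Probability.Levy"
begin

text \<open>
  In the CMV basis, multiplication by \<open>z\<close> in \<open>L\<^sup>2(\<mu>)\<close> is the half-line CMV matrix, and the \<open>n\<close>-th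
  basis function has modulus \<open>|\<phi>\<^sub>n|\<close> on the circle. So the moments of \<open>|\<phi>\<^sub>n|\<^sup>2 d\<mu>\<close> are the
  diagonal entries of powers of the matrix, and along a sequence defining a right limit they converge
  to the diagonal entries of the powers of the right limit \<open>E\<close>.

  For \<open>k < \<infinity>\<close> this determines the coefficients of \<open>E\<close>. If \<open>a\<^sub>q\<close> and \<open>a\<^sub>p\<close> are separated by zeros only,
  then the \<open>(p, p)\<close> entry of \<open>E\<^bsup>p-q\<^esup>\<close> is \<open>-a\<^sub>q cnj(a\<^sub>p)\<close>. Hence the nonzero coefficients form an arithmetic
  progression of step \<open>k\<close> on which \<open>-a\<^sub>q cnj(a\<^bsub>q+k\<^esub>) = c\<close>. The diagonal entries of powers do not
  change from \<open>n\<close> to \<open>n + 1\<close>: if \<open>a\<^sub>n = 0\<close>, then \<open>\<Theta>\<^sub>n\<close> swaps the two coordinates; otherwise reflection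
  of the line about this block multiplies all coefficients by a unimodular constant, which amounts to
  conjugation by a diagonal unitary. The common spectral measure is a weak limit of
  \<open>|\<phi>\<^sub>n|\<^sup>2 d\<mu>\<close>.
\<close>

section \<open>Diagonal entries of powers of whole-line matrices\<close>

lemma infsum_single:
  fixes f :: "'i \<Rightarrow> complex"
  assumes "\<And>i. i \<noteq> n \<Longrightarrow> f i = 0"
  shows "(\<Sum>\<^sub>\<infinity>i. f i) = f n"
proof -
  have "(\<Sum>\<^sub>\<infinity>i. f i) = (\<Sum>\<^sub>\<infinity>i\<in>{n}. f i)"
    by (rule infsum_cong_neutral) (use assms in auto)
  then show ?thesis by simp
qed

lemma l2_inner_delta [simp]: "l2_inner (delta n) x = x n"
proof -
  have "l2_inner (delta n) x = cnj (delta n n) * x n"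
    unfolding l2_inner_def by (rule infsum_single) (simp add: delta_def)
  then show ?thesis by (simp add: delta_def)
qed

lemma entry_eq [simp]: "entry A m n = A (delta n) m"
  by (simp add: entry_def)

lemma cnj_rho [simp]: "cnj (rho a) = rho a"
  by (simp add: rho_def)

lemma rho_0 [simp]: "rho 0 = 1"
  by (simp add: rho_def)

lemma rho_minus [simp]: "rho (- a) = rho a"
  by (simp add: rho_def)

lemma rho_cnj [simp]: "rho (cnj a) = rho a"
  by (simp add: rho_def)

lemma rho_mult_unit: "cmod t = 1 \<Longrightarrow> rho (t * a) = rho a"
  by (simp add: rho_def norm_mult)

text \<open>\<open>block True\<close> is \<open>whole_L\<close> and \<open>block False\<close> is \<open>whole_M\<close>; the parity argument lets shifts by odd
  integers, which exchange the two, be treated uniformly.\<close>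

definition block :: "bool \<Rightarrow> (int \<Rightarrow> complex) \<Rightarrow> (int \<Rightarrow> complex) \<Rightarrow> (int \<Rightarrow> complex)" where
  "block e a x = (\<lambda>n. if even n = e then cnj (a n) * x n + rho (a n) * x (n + 1)
                    else rho (a (n - 1)) * x (n - 1) - a (n - 1) * x n)"

lemma whole_L_eq_block: "whole_L a = block True a"
  by (auto simp: whole_L_def block_def fun_eq_iff)

lemma whole_M_eq_block: "whole_M a = block False a"
  by (auto simp: whole_M_def block_def fun_eq_iff)

definition cmv :: "bool \<Rightarrow> (int \<Rightarrow> complex) \<Rightarrow> (int \<Rightarrow> complex) \<Rightarrow> (int \<Rightarrow> complex)" where
  "cmv e a = block e a \<circ> block (\<not> e) a"

lemma cmv_power_Suc: "(cmv e a ^^ Suc l) x = block e a (block (\<not> e) a ((cmv e a ^^ l) x))"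
  by (simp add: cmv_def)

lemma cmv_power_Suc_right: "(cmv e a ^^ Suc l) x = (cmv e a ^^ l) (block e a (block (\<not> e) a x))"
  by (simp add: funpow_Suc_right cmv_def del: funpow.simps)

lemma whole_CMV_eq_cmv: "whole_CMV a = cmv True a"
  by (simp add: whole_CMV_def cmv_def whole_L_eq_block whole_M_eq_block)

section \<open>Linearity and transposition\<close>

definition lin_op :: "((int \<Rightarrow> complex) \<Rightarrow> (int \<Rightarrow> complex)) \<Rightarrow> bool" where
  "lin_op T \<longleftrightarrow> (\<forall>s t x y. T (\<lambda>i. s * x i + t * y i) = (\<lambda>i. s * T x i + t * T y i))"

lemma lin_op_block: "lin_op (block e a)"
  by (auto simp: lin_op_def block_def fun_eq_iff algebra_simps)

lemma lin_op_comp: "lin_op S \<Longrightarrow> lin_op T \<Longrightarrow> lin_op (S \<circ> T)"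
  by (simp add: lin_op_def)

lemma lin_op_cmv_power: "lin_op (cmv e a ^^ l)"
proof (induction l)
  case 0 then show ?case by (simp add: lin_op_def)
next
  case (Suc l) then show ?case
    unfolding funpow.simps by (intro lin_op_comp) (auto simp only: cmv_def intro!: lin_op_comp lin_op_block)
qed

lemma block_delta:
  "block e a (delta n) =
    (if even n = e then (\<lambda>m. cnj (a n) * delta n m + rho (a n) * delta (n + 1) m)
     else (\<lambda>m. rho (a (n - 1)) * delta (n - 1) m + (- a (n - 1)) * delta n m))"
  by (auto simp: block_def delta_def fun_eq_iff)

definition transposes ::
  "((int \<Rightarrow> complex) \<Rightarrow> (int \<Rightarrow> complex)) \<Rightarrow> ((int \<Rightarrow> complex) \<Rightarrow> (int \<Rightarrow> complex)) \<Rightarrow> bool" where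
  "transposes S T \<longleftrightarrow> (\<forall>m n. S (delta n) m = T (delta m) n)"

text \<open>The rule that transposing a product reverses the factors, with a symmetric first factor.
  It is tested on basis vectors only; linearity of \<open>T\<close> is needed because the block
  sends \<open>delta m\<close> to a combination of two of them.\<close>

lemma transposes_block_comp:
  assumes "transposes S T" "lin_op T"
  shows "transposes (block e a \<circ> S) (T \<circ> block e a)"
  unfolding transposes_def
proof (intro allI)
  fix m n
  have T: "T (\<lambda>i. s * x i + t * y i) = (\<lambda>i. s * T x i + t * T y i)" for s t x y
    using assms(2) by (simp add: lin_op_def)
  have S: "S (delta n) m = T (delta m) n" for m n
    using assms(1) by (simp add: transposes_def)
  show "(block e a \<circ> S) (delta n) m = (T \<circ> block e a) (delta m) n"
  proof (cases "even m = e")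
    case True
    then show ?thesis by (simp add: block_delta T) (simp add: block_def S)
  next
    case False
    then have "block e a (delta m) = (\<lambda>i. rho (a (m - 1)) * delta (m - 1) i + (- a (m - 1)) * delta m i)"
      by (simp only: block_delta if_False)
    then show ?thesis using False by (simp only: comp_apply T) (simp add: block_def S)
  qed
qed

lemma transposes_cmv_power: "transposes (cmv e a ^^ l) (cmv (\<not> e) a ^^ l)"
proof (induction l)
  case 0 then show ?case by (simp add: transposes_def delta_def)
next
  case (Suc l)
  have "transposes (block e a \<circ> (block (\<not> e) a \<circ> cmv e a ^^ l)) ((cmv (\<not> e) a ^^ l \<circ> block (\<not> e) a) \<circ> block e a)"
    by (intro transposes_block_comp lin_op_comp lin_op_block lin_op_cmv_power Suc)
  moreover have "cmv (\<not> e) a ^^ Suc l = (cmv (\<not> e) a ^^ l \<circ> block (\<not> e) a) \<circ> block e a"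
    unfolding funpow_Suc_right by (simp only: cmv_def comp_assoc not_not)
  moreover have "cmv e a ^^ Suc l = block e a \<circ> (block (\<not> e) a \<circ> cmv e a ^^ l)"
    by (simp only: funpow.simps cmv_def comp_assoc)
  ultimately show ?case by (simp only:)
qed

definition diag_power :: "bool \<Rightarrow> (int \<Rightarrow> complex) \<Rightarrow> nat \<Rightarrow> int \<Rightarrow> complex" where
  "diag_power e a l n = (cmv e a ^^ l) (delta n) n"

text \<open>Both factors are symmetric matrices, so transposition turns \<open>LM\<close> into \<open>ML\<close>.\<close>

lemma diag_power_parity: "diag_power e a l n = diag_power e' a l n"
proof -
  have "diag_power e a l n = diag_power (\<not> e) a l n" for e
    using transposes_cmv_power[of l e a] by (simp add: diag_power_def transposes_def)
  from this[of True] show ?thesis by (cases e; cases e') simp_all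
qed

lemma cmv_power_block: "(cmv e a ^^ l) (block e a x) = block e a ((cmv (\<not> e) a ^^ l) x)"
  by (induction l) (simp_all add: cmv_power_Suc del: funpow.simps(2))

text \<open>If \<open>a n = 0\<close> then the block at \<open>n\<close> swaps the coordinates \<open>n\<close> and \<open>n + 1\<close>.\<close>

lemma diag_power_slide:
  assumes "a n = 0"
  shows "diag_power e a l n = diag_power e a l (n + 1)"
proof -
  define f where "f = even n"
  have "block f a (delta (n + 1)) = delta n"
    using assms by (simp add: block_delta f_def)
  then have "diag_power f a l n = block f a ((cmv (\<not> f) a ^^ l) (delta (n + 1))) n"
    by (metis diag_power_def cmv_power_block)
  also have "\<dots> = diag_power (\<not> f) a l (n + 1)"
    using assms by (simp add: block_def diag_power_def f_def)
  finally show ?thesis by (metis diag_power_parity)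
qed

section \<open>Symmetries: translation, reflection, gauge\<close>

lemma block_shift: "block e a x (n + t) = block (even t = e) (\<lambda>m. a (m + t)) (\<lambda>m. x (m + t)) n"
  by (auto simp: block_def algebra_simps)

lemma cmv_power_shift:
  "(cmv e a ^^ l) x (n + t) = (cmv (even t = e) (\<lambda>m. a (m + t)) ^^ l) (\<lambda>m. x (m + t)) n"
proof (induction l arbitrary: n)
  case (Suc l)
  then have *: "(\<lambda>m. (cmv e a ^^ l) x (m + t)) = (cmv (even t = e) (\<lambda>m. a (m + t)) ^^ l) (\<lambda>m. x (m + t))"
    by blast
  have "(cmv e a ^^ Suc l) x (n + t) = block (even t = e) (\<lambda>m. a (m + t))
      (\<lambda>m. block (\<not> e) a ((cmv e a ^^ l) x) (m + t)) n"
    by (simp only: cmv_power_Suc block_shift)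
  also have "(\<lambda>m. block (\<not> e) a ((cmv e a ^^ l) x) (m + t)) =
     block (\<not> (even t = e)) (\<lambda>m. a (m + t)) (\<lambda>m. (cmv e a ^^ l) x (m + t))"
    by (auto simp: block_shift fun_eq_iff)
  finally show ?case by (simp only: * cmv_power_Suc)
qed simp

lemma diag_power_shift: "diag_power e a l (n + t) = diag_power e (\<lambda>m. a (m + t)) l n"
proof -
  have "(\<lambda>m. delta (n + t) (m + t)) = delta n"
    by (auto simp: delta_def)
  then have "diag_power e a l (n + t) = diag_power (even t = e) (\<lambda>m. a (m + t)) l n"
    by (simp add: diag_power_def cmv_power_shift)
  then show ?thesis by (metis diag_power_parity)
qed

text \<open>The reflection carries the block at \<open>m\<close> to the block at
  \<open>2 * p - m\<close> and swaps its two coordinates; swapping the coordinates of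
  \<open>Theta z\<close> gives \<open>Theta (- cnj z)\<close>.\<close>

lemma block_reflect:
  "block e a x (2 * p + 1 - n) = block e (\<lambda>m. - cnj (a (2 * p - m))) (\<lambda>m. x (2 * p + 1 - m)) n"
  by (auto simp: block_def algebra_simps)

lemma cmv_power_reflect:
  "(cmv e a ^^ l) x (2 * p + 1 - n) = (cmv e (\<lambda>m. - cnj (a (2 * p - m))) ^^ l) (\<lambda>m. x (2 * p + 1 - m)) n"
proof (induction l arbitrary: n)
  case (Suc l)
  then have *: "(\<lambda>m. (cmv e a ^^ l) x (2 * p + 1 - m)) = (cmv e (\<lambda>m. - cnj (a (2 * p - m))) ^^ l) (\<lambda>m. x (2 * p + 1 - m))"
    by blast
  show ?case
    by (simp only: cmv_power_Suc block_reflect *)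
qed simp

lemma diag_power_reflect: "diag_power e a l (n + 1) = diag_power e (\<lambda>m. - cnj (a (2 * n - m))) l n"
proof -
  have "(\<lambda>m. delta (n + 1) (2 * n + 1 - m)) = delta n"
    by (auto simp: delta_def)
  then show ?thesis
    using cmv_power_reflect[of l e a "delta (n + 1)" n n] by (simp add: diag_power_def)
qed

text \<open>\<open>Theta (s\<^sup>2 * a) = D * Theta a * D\<close> with \<open>D = diag (cnj s, s)\<close>, and the diagonal matrices needed
  for the two factors are inverse to each other.\<close>

lemma block_gauge:
  assumes "cmod s = 1"
  shows "block e (\<lambda>m. s\<^sup>2 * a m) x n =
    (if even n = e then cnj s else s) * block e a (\<lambda>m. (if even m = e then cnj s else s) * x m) n"
proof -
  have s: "s * cnj s = 1" "cnj s * s = 1"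
    using assms by (simp_all add: complex_norm_square[symmetric] mult.commute)
  have s': "s * (cnj s * z) = z" "cnj s * (s * z) = z" for z
    by (simp_all add: s mult.assoc[symmetric])
  have r: "rho (s\<^sup>2 * z) = rho z" for z
    by (rule rho_mult_unit) (simp add: assms norm_power)
  show ?thesis
    unfolding block_def r
    by (auto simp: algebra_simps power2_eq_square s s')
qed

lemma cmv_power_gauge:
  assumes "cmod s = 1"
  shows "(cmv e (\<lambda>m. s\<^sup>2 * a m) ^^ l) (\<lambda>m. (if even m = e then cnj s else s) * x m) =
    (\<lambda>m. (if even m = e then cnj s else s) * (cmv e a ^^ l) x m)"
proof (induction l)
  case (Suc l)
  have s: "s * cnj s = 1" "cnj s * s = 1" "s * (cnj s * z) = z" "cnj s * (s * z) = z" for z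
    using assms by (simp_all add: complex_norm_square[symmetric] mult.commute mult.assoc[symmetric])
  have 1: "block (\<not> e) (\<lambda>m. s\<^sup>2 * a m) (\<lambda>m. (if even m = e then cnj s else s) * y m) =
    (\<lambda>m. (if even m = e then s else cnj s) * block (\<not> e) a y m)" for y
  proof
    fix n
    have "(\<lambda>m. (if even m = (\<not> e) then cnj s else s) * ((if even m = e then cnj s else s) * y m)) = y"
      by (auto simp: s)
    then show "block (\<not> e) (\<lambda>m. s\<^sup>2 * a m) (\<lambda>m. (if even m = e then cnj s else s) * y m) n =
      (if even n = e then s else cnj s) * block (\<not> e) a y n"
      unfolding block_gauge[OF assms] by auto
  qed
  have 2: "block e (\<lambda>m. s\<^sup>2 * a m) (\<lambda>m. (if even m = e then s else cnj s) * y m) =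
    (\<lambda>m. (if even m = e then cnj s else s) * block e a y m)" for y
  proof
    fix n
    have "(\<lambda>m. (if even m = e then cnj s else s) * ((if even m = e then s else cnj s) * y m)) = y"
      by (auto simp: s)
    then show "block e (\<lambda>m. s\<^sup>2 * a m) (\<lambda>m. (if even m = e then s else cnj s) * y m) n =
      (if even n = e then cnj s else s) * block e a y n"
      unfolding block_gauge[OF assms] by simp
  qed
  show ?case
    by (simp only: cmv_power_Suc Suc 1 2)
qed simp

lemma diag_power_gauge:
  assumes "cmod t = 1"
  shows "diag_power e (\<lambda>m. t * a m) l n = diag_power e a l n"
proof -
  define s where "s = csqrt t"
  have s: "s\<^sup>2 = t" "cmod s = 1"
    using assms by (simp_all add: s_def norm_csqrt)
  define f :: "int \<Rightarrow> complex" where "f = (\<lambda>m. if even m = e then cnj s else s)"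
  have s1: "s \<noteq> 0" "s * cnj s = 1"
    using s(2) by (auto simp: complex_norm_square[symmetric])
  define x where "x = (\<lambda>m. delta n m / f n)"
  have "(\<lambda>m. f m * x m) = delta n"
    using s1 by (auto simp: x_def delta_def f_def)
  then have 1: "diag_power e (\<lambda>m. t * a m) l n = f n * (cmv e a ^^ l) x n"
    using cmv_power_gauge[OF s(2), of l e a x] by (simp add: diag_power_def s(1) f_def)
  have "x = (\<lambda>m. (1 / f n) * delta n m + 0 * delta n m)"
    by (simp add: x_def)
  then have "(cmv e a ^^ l) x = (\<lambda>m. (1 / f n) * (cmv e a ^^ l) (delta n) m + 0 * (cmv e a ^^ l) (delta n) m)"
    using lin_op_cmv_power[of l e a] unfolding lin_op_def by metis
  then show ?thesis
    using 1 s1 by (simp add: diag_power_def f_def)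
qed

text \<open>Coordinatewise convergence suffices because the matrices are banded: a coordinate of a
  power depends on finitely many coefficients.\<close>

lemma cmv_power_tendsto:
  assumes "\<And>n. (\<lambda>j. b j n) \<longlonglongrightarrow> a n"
  shows "(\<lambda>j. (cmv e (b j) ^^ l) x n) \<longlonglongrightarrow> (cmv e a ^^ l) x n"
proof (induction l arbitrary: n)
  case (Suc l)
  have r: "(\<lambda>j. rho (b j n)) \<longlonglongrightarrow> rho (a n)" for n
    unfolding rho_def by (intro tendsto_intros assms)
  have "(\<lambda>j. block e (b j) (y j) n) \<longlonglongrightarrow> block e a z n" if "\<And>n. (\<lambda>j. y j n) \<longlonglongrightarrow> z n" for y z e n
    unfolding block_def by (cases "even n = e") (auto intro!: tendsto_intros assms r that)
  then show ?case
    using Suc by (simp only: cmv_power_Suc)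
qed simp

text \<open>The wave packet started at \<open>n\<close> travels through the zeros to the left, is reflected at
  \<open>n - g\<close>, and its front returns to \<open>n\<close> after \<open>2 * g - 1\<close> half-steps.\<close>

lemma diag_power_gap_aux:
  assumes "g \<ge> 1" "\<And>m. n - int g < m \<Longrightarrow> m < n \<Longrightarrow> a m = 0"
  shows "block (odd n) a ((cmv (even n) a ^^ (g - 1)) (delta n)) n = - a (n - int g) \<and>
    (\<forall>m>n. block (odd n) a ((cmv (even n) a ^^ (g - 1)) (delta n)) m = 0)"
  using assms
proof (induction g arbitrary: n rule: nat_induct_at_least)
  case base
  then show ?case by (auto simp: block_delta) (auto simp: delta_def)
next
  case (Suc g)
  from Suc.hyps have a: "a (n - 1) = 0" by (intro Suc.prems) auto
  define y where "y = block (odd (n - 1)) a ((cmv (even (n - 1)) a ^^ (g - 1)) (delta (n - 1)))"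
  have "y (n - 1) = - a (n - 1 - int g) \<and> (\<forall>m>n-1. y m = 0)"
    unfolding y_def by (rule Suc.IH) (use Suc.prems in auto)
  then have y: "y (n - 1) = - a (n - int (Suc g))" "\<And>m. m > n - 1 \<Longrightarrow> y m = 0"
    by (simp_all add: algebra_simps)
  have d: "block (odd n) a (delta n) = delta (n - 1)"
    by (simp add: block_delta a)
  \<comment> \<open>The first half-step swaps \<open>delta n\<close> into
    \<open>delta (n - 1)\<close>. Commuting a block to the front leaves the packet of the induction
    hypothesis, started at \<open>n - 1\<close> with gap \<open>g\<close>; the last block then swaps
    its front back to \<open>n\<close>.\<close>
  have "(cmv (even n) a ^^ g) (delta n) = (cmv (even n) a ^^ (g - 1)) (block (even n) a (delta (n - 1)))"
    using Suc.hyps by (cases g) (simp_all add: cmv_power_Suc_right d del: funpow.simps(2))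
  also have "\<dots> = y"
    by (simp add: cmv_power_block y_def)
  finally have "(cmv (even n) a ^^ (Suc g - 1)) (delta n) = y" by simp
  then show ?case
    using y by (simp add: block_def a)
qed

text \<open>The last half-step acts on coordinates \<open>n\<close> and \<open>n + 1\<close>. The
  packet vanishes at \<open>n + 1\<close>, so its front only picks up the factor
  \<open>cnj (a n)\<close>.\<close>

lemma diag_power_gap:
  assumes "g \<ge> 1" "\<And>m. n - int g < m \<Longrightarrow> m < n \<Longrightarrow> a m = 0"
  shows "diag_power e a g n = - a (n - int g) * cnj (a n)"
proof -
  note * = diag_power_gap_aux[of g n a, OF assms]
  have "diag_power (even n) a g n = block (even n) a (block (odd n) a ((cmv (even n) a ^^ (g - 1)) (delta n))) n"
    using assms(1) by (cases g) (simp_all add: diag_power_def cmv_power_Suc del: funpow.simps(2))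
  also have "\<dots> = - a (n - int g) * cnj (a n)"
    using * by (subst block_def) simp
  finally show ?thesis by (metis diag_power_parity)
qed

section \<open>Coefficients determined by the first moments\<close>

locale gap_moments =
  fixes e :: bool and a :: "int \<Rightarrow> complex" and k :: nat and c :: complex
  assumes k: "k \<ge> 1" and c: "c \<noteq> 0"
    and low: "\<And>l n. 1 \<le> l \<Longrightarrow> l < k \<Longrightarrow> diag_power e a l n = 0"
    and top: "\<And>n. diag_power e a k n = c"
begin

text \<open>Induction to the right from \<open>q\<close>: once the coefficients strictly between
  \<open>q\<close> and \<open>m\<close> vanish, the moment of order \<open>m - q\<close> at
  \<open>m\<close> is \<open>- a q * cnj (a m)\<close>, and it is zero.\<close>

lemma zero_between:
  assumes "a q \<noteq> 0" "q < m" "m < q + int k"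
  shows "a m = 0"
  using assms(2,3)
proof (induction "nat (m - q)" arbitrary: m rule: less_induct)
  case less
  define g where "g = nat (m - q)"
  have g: "m - int g = q" "1 \<le> g" "g < k"
    using less.prems by (auto simp: g_def)
  have "diag_power e a g m = - a (m - int g) * cnj (a m)"
    by (rule diag_power_gap[OF g(2)], rule less.hyps) (use g less.prems in auto)
  then show ?case
    using low[of g m] g assms(1) by simp
qed

lemma step:
  assumes "a q \<noteq> 0"
  shows "- a q * cnj (a (q + int k)) = c"
proof -
  have "diag_power e a k (q + int k) = - a (q + int k - int k) * cnj (a (q + int k))"
    by (rule diag_power_gap[OF k], rule zero_between) (use assms in auto)
  then show ?thesis by (simp add: top)
qed

lemma nonzero_up: "a q \<noteq> 0 \<Longrightarrow> a (q + int k) \<noteq> 0"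
  using step[of q] c by auto

lemma nonzero_down:
  assumes "a q \<noteq> 0"
  shows "a (q - int k) \<noteq> 0"
proof -
  \<comment> \<open>Otherwise the \<open>k\<close> coefficients ending at \<open>q - 1\<close> all
    vanish, and so does the moment of order \<open>k\<close> at \<open>q - 1\<close>, which is
    \<open>c\<close>. By \<open>zero_between\<close> a nonzero one among them can only sit at
    \<open>q - int k\<close>.\<close>
  have "\<exists>m. q - 1 - int k < m \<and> m \<le> q - 1 \<and> a m \<noteq> 0"
  proof (rule ccontr)
    assume "\<not> ?thesis"
    then have z: "a m = 0" if "q - 1 - int k < m" "m \<le> q - 1" for m using that by auto
    then have "diag_power e a k (q - 1) = - a (q - 1 - int k) * cnj (a (q - 1))"
      by (intro diag_power_gap[OF k]) auto
    then show False using top z[of "q - 1"] c k by simp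
  qed
  then obtain m where m: "q - 1 - int k < m" "m \<le> q - 1" "a m \<noteq> 0" by auto
  have "q \<ge> m + int k"
    using zero_between[of m q] m assms by linarith
  with m have "m = q - int k" by linarith
  then show ?thesis using m by simp
qed

lemma nonzero_multiple:
  assumes "a q \<noteq> 0"
  shows "a (q + j * int k) \<noteq> 0"
proof (induction j rule: int_induct[where k = 0])
  case (step1 i) then show ?case using nonzero_up[of "q + i * int k"] by (simp add: algebra_simps)
next
  case (step2 i) then show ?case using nonzero_down[of "q + i * int k"] by (simp add: algebra_simps)
qed (use assms in simp)

lemma zero_nonmultiple:
  assumes "a q \<noteq> 0" "\<not> int k dvd m - q"
  shows "a m = 0"
proof (rule zero_between)
  show "a (q + (m - q) div int k * int k) \<noteq> 0" by (rule nonzero_multiple[OF assms(1)])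
  have 1: "m = q + (m - q) div int k * int k + (m - q) mod int k" by simp
  have "(m - q) mod int k \<noteq> 0" "(m - q) mod int k \<ge> 0" "(m - q) mod int k < int k"
    using assms(2) k by (auto simp: dvd_eq_mod_eq_0)
  then show "q + (m - q) div int k * int k < m" "m < q + (m - q) div int k * int k + int k"
    using 1 by linarith+
qed

text \<open>The symmetry spreads outwards: by \<open>step\<close>, the products
  \<open>cnj u * u'\<close> and \<open>cnj v' * v\<close> of neighbours on the two sides are both
  \<open>- cnj c\<close>, so it passes from the inner pair to the outer one.\<close>

lemma symmetric_nat:
  assumes n: "a n \<noteq> 0"
  shows "cnj (a (n - int j * int k)) * a n = cnj (a n) * a (n + int j * int k)"
proof (induction j)
  case (Suc j)
  define u v where "u = a (n + int j * int k)" and "v = a (n - int j * int k)"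
  define u' v' where "u' = a (n + int (Suc j) * int k)" and "v' = a (n - int (Suc j) * int k)"
  have nz: "u \<noteq> 0" "v \<noteq> 0" "v' \<noteq> 0"
    using nonzero_multiple[OF n, of "int j"] nonzero_multiple[OF n, of "- int j"] nonzero_multiple[OF n, of "- int (Suc j)"]
    by (simp_all only: u_def v_def v'_def diff_conv_add_uminus mult_minus_left not_False_eq_True)
  have "- u * cnj u' = c"
    using step[of "n + int j * int k"] nz by (simp add: u_def u'_def algebra_simps)
  from this[symmetric] have 1: "cnj u * u' = - cnj c"
    by simp
  have "- v' * cnj v = c"
    using step[of "n - int (Suc j) * int k"] nz by (simp add: v_def v'_def algebra_simps)
  from this[symmetric] have 2: "cnj v' * v = - cnj c"
    by simp
  have IH: "cnj v * a n = cnj (a n) * u" using Suc by (simp add: u_def v_def)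
  have IH': "cnj u * a n = cnj (a n) * v"
    using arg_cong[OF IH, of cnj] by (simp add: mult.commute)
  have "cnj u * (cnj v' * a n) = cnj (a n) * (cnj v' * v)"
    using IH' by (metis mult.assoc mult.left_commute)
  also have "\<dots> = cnj u * (cnj (a n) * u')"
    using 1 2 by (simp add: mult.left_commute[of "cnj u"])
  finally show ?case using nz by (simp add: u'_def v'_def)
qed simp

lemma symmetric:
  assumes n: "a n \<noteq> 0"
  shows "cnj (a (n - j * int k)) * a n = cnj (a n) * a (n + j * int k)"
proof (cases "j \<ge> 0")
  case True
  then show ?thesis using symmetric_nat[OF n, of "nat j"] by simp
next
  case False
  then have "cnj (a (n + j * int k)) * a n = cnj (a n) * a (n - j * int k)"
    using symmetric_nat[OF n, of "nat (- j)"] by simp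
  from arg_cong[OF this, of cnj] show ?thesis by (simp add: mult.commute)
qed

text \<open>At a nonzero coefficient, reflecting the line about the block at \<open>n\<close> multiplies all
  coefficients by the unimodular constant \<open>t\<close> below.\<close>

lemma diag_power_step: "diag_power e a l (n + 1) = diag_power e a l n"
proof (cases "a n = 0")
  case True
  then show ?thesis using diag_power_slide by metis
next
  case n: False
  define t where "t = - cnj (a n) / a n"
  have "cmod t = 1" using n by (simp add: t_def norm_divide)
  have "(\<lambda>m. - cnj (a (2 * n - m))) = (\<lambda>m. t * a m)"
  proof
    fix m
    show "- cnj (a (2 * n - m)) = t * a m"
    proof (cases "int k dvd m - n")
      case True
      then obtain j where "m - n = int k * j" by (auto elim: dvdE)
      then have j: "m = n + j * int k" "2 * n - m = n - j * int k" by (simp_all add: mult.commute)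
      show ?thesis using symmetric[OF n, of j] n unfolding j t_def by (simp add: field_simps)
    next
      case False
      moreover from this have "\<not> int k dvd (2 * n - m) - n"
        by (metis add_diff_cancel_left' diff_diff_eq2 dvd_diff_commute mult_2)
      ultimately show ?thesis using zero_nonmultiple[OF n] by simp
    qed
  qed
  then show ?thesis
    unfolding diag_power_reflect by (simp add: diag_power_gauge \<open>cmod t = 1\<close>)
qed

lemma diag_power_const: "diag_power e a l n = diag_power e a l 0"
  by (induction n rule: int_induct[where k = 0]) (use diag_power_step in \<open>simp, metis, metis diff_add_cancel\<close>)

end

section \<open>Half-line matrices\<close>

text \<open>As \<open>Theta (- 1)\<close> is diagonal, the coefficient at \<open>-1\<close> splits the whole-line matrix into two
  half-line matrices. The remaining negative coefficients play no role.\<close>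

definition ext :: "(nat \<Rightarrow> complex) \<Rightarrow> int \<Rightarrow> complex" where
  "ext \<alpha> n = (if n < 0 then - 1 else \<alpha> (nat n))"

lemma rho_1 [simp]: "rho 1 = 0"
  by (simp add: rho_def)

lemma half_L_block:
  assumes "\<And>n. x (int n) = y n"
  shows "block True (ext \<alpha>) x (int n) = half_L \<alpha> y n"
  using assms[of n] assms[of "n + 1"] assms[of "n - 1"]
  by (auto simp: block_def half_L_def ext_def nat_diff_distrib' of_nat_diff add.commute elim: oddE)

text \<open>Coordinate 0 is the second one of the block at -1, which is \<open>Theta (- 1)\<close>
  and acts there as 1; this is the leading entry of \<open>half_M\<close>.\<close>

lemma half_M_block:
  assumes "\<And>n. x (int n) = y n"
  shows "block False (ext \<alpha>) x (int n) = half_M \<alpha> y n"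
  using assms[of n] assms[of "n + 1"] assms[of "n - 1"]
  by (cases n) (auto simp: block_def half_M_def ext_def nat_add_distrib add.commute)

lemma half_LM_power_cmv:
  assumes "\<And>n. x (int n) = y n"
  shows "(cmv True (ext \<alpha>) ^^ l) x (int n) = ((half_L \<alpha> \<circ> half_M \<alpha>) ^^ l) y n"
proof (induction l arbitrary: n)
  case (Suc l)
  show ?case
    unfolding cmv_power_Suc using half_L_block half_M_block Suc by simp
qed (use assms in simp)

lemma half_ML_power_cmv:
  assumes "\<And>n. x (int n) = y n"
  shows "(cmv False (ext \<alpha>) ^^ l) x (int n) = ((half_M \<alpha> \<circ> half_L \<alpha>) ^^ l) y n"
proof (induction l arbitrary: n)
  case (Suc l)
  show ?case
    unfolding cmv_power_Suc using half_L_block half_M_block Suc by simp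
qed (use assms in simp)

lemma delta_int: "delta (int n) (int m) = delta n m"
  by (simp add: delta_def)

lemma half_CMV_diag_power: "(half_CMV \<alpha> ^^ l) (delta n) n = diag_power e (ext \<alpha>) l (int n)"
  using half_LM_power_cmv[of "delta (int n)" "delta n" l \<alpha> n] diag_power_parity[of e "ext \<alpha>" l "int n" True]
  by (simp add: diag_power_def half_CMV_def delta_int)

definition half_ML :: "(nat \<Rightarrow> complex) \<Rightarrow> (nat \<Rightarrow> complex) \<Rightarrow> (nat \<Rightarrow> complex)" where
  "half_ML \<alpha> = half_M \<alpha> \<circ> half_L \<alpha>"

text \<open>Conjugated moments arise as entries of powers of \<open>half_ML\<close> with conjugate
  coefficients; this returns them to \<open>half_CMV\<close>.\<close>

lemma half_LM_ML: "(half_ML \<alpha> ^^ l) (delta n) n = (half_CMV \<alpha> ^^ l) (delta n) n"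
  using half_LM_power_cmv[of "delta (int n)" "delta n" l \<alpha> n] half_ML_power_cmv[of "delta (int n)" "delta n" l \<alpha> n]
    diag_power_parity[of True "ext \<alpha>" l "int n" False]
  by (simp add: diag_power_def delta_int half_ML_def half_CMV_def)

text \<open>Translated by \<open>s j\<close>, the coefficients \<open>ext \<alpha>\<close> converge
  pointwise. An odd translation exchanges the two factors, which diagonal entries do not
  notice.\<close>

lemma right_limit_diag_power:
  assumes s: "filterlim s at_top sequentially" and lim: "\<And>n. (\<lambda>j. \<alpha> (nat (n + s j))) \<longlonglongrightarrow> \<beta> n"
  shows "(\<lambda>j. (half_CMV \<alpha> ^^ l) (delta (nat (n + s j))) (nat (n + s j))) \<longlonglongrightarrow> diag_power True \<beta> l n"
proof -
  have pos: "eventually (\<lambda>j. n + s j \<ge> 0) sequentially" for n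
    using s unfolding filterlim_at_top by (auto elim!: allE[of _ "- n"] elim: eventually_mono)
  have "(\<lambda>j. ext \<alpha> (n + s j)) \<longlonglongrightarrow> \<beta> n" for n
    using lim[of n] by (rule Lim_transform_eventually) (use pos[of n] in eventually_elim, simp add: ext_def)
  then have "(\<lambda>j. diag_power True (\<lambda>m. ext \<alpha> (m + s j)) l n) \<longlonglongrightarrow> diag_power True \<beta> l n"
    unfolding diag_power_def by (rule cmv_power_tendsto)
  then show ?thesis
  proof (rule Lim_transform_eventually)
    show "\<forall>\<^sub>F j in sequentially. diag_power True (\<lambda>m. ext \<alpha> (m + s j)) l n =
      (half_CMV \<alpha> ^^ l) (delta (nat (n + s j))) (nat (n + s j))"
      using pos[of n] by eventually_elim (simp add: half_CMV_diag_power[where e = True] diag_power_shift[symmetric])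
  qed
qed

text \<open>The blocks are unitary, and the adjoint of \<open>Theta a\<close> is \<open>Theta (cnj a)\<close>.\<close>

abbreviation half_L_inv :: "(nat \<Rightarrow> complex) \<Rightarrow> (nat \<Rightarrow> complex) \<Rightarrow> (nat \<Rightarrow> complex)" where
  "half_L_inv \<alpha> \<equiv> half_L (\<lambda>n. cnj (\<alpha> n))"

abbreviation half_M_inv :: "(nat \<Rightarrow> complex) \<Rightarrow> (nat \<Rightarrow> complex) \<Rightarrow> (nat \<Rightarrow> complex)" where
  "half_M_inv \<alpha> \<equiv> half_M (\<lambda>n. cnj (\<alpha> n))"

lemma rho_sq: "cmod a \<le> 1 \<Longrightarrow> rho a * rho a = 1 - a * cnj a"
  by (simp add: rho_def complex_norm_square[symmetric] power2_eq_square[symmetric] abs_square_le_1 flip: of_real_mult of_real_power)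

lemma Theta_inv:
  assumes "cmod a \<le> 1"
  shows "a * (cnj a * x + rho a * y) + rho a * (rho a * x - a * y) = x"
    and "rho a * (cnj a * x + rho a * y) - cnj a * (rho a * x - a * y) = y"
  using rho_sq[OF assms] by algebra+

lemma half_L_inv_left:
  assumes "\<And>n. cmod (\<alpha> n) \<le> 1"
  shows "half_L_inv \<alpha> (half_L \<alpha> x) = x"
proof
  fix n
  show "half_L_inv \<alpha> (half_L \<alpha> x) n = x n"
    using Theta_inv[OF assms] by (simp add: half_L_def)
qed

lemma half_M_inv_left:
  assumes "\<And>n. cmod (\<alpha> n) \<le> 1"
  shows "half_M_inv \<alpha> (half_M \<alpha> x) = x"
proof
  fix n
  show "half_M_inv \<alpha> (half_M \<alpha> x) n = x n"
    using Theta_inv[OF assms] by (cases n) (simp_all add: half_M_def)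
qed

lemma half_L_inv_right: "(\<And>n. cmod (\<alpha> n) \<le> 1) \<Longrightarrow> half_L \<alpha> (half_L_inv \<alpha> x) = x"
  using half_L_inv_left[of "\<lambda>n. cnj (\<alpha> n)" x] by simp

lemma half_M_inv_right: "(\<And>n. cmod (\<alpha> n) \<le> 1) \<Longrightarrow> half_M \<alpha> (half_M_inv \<alpha> x) = x"
  using half_M_inv_left[of "\<lambda>n. cnj (\<alpha> n)" x] by simp

lemma half_L_lin: "half_L \<alpha> (\<lambda>i. s * x i + t * y i) = (\<lambda>i. s * half_L \<alpha> x i + t * half_L \<alpha> y i)"
  by (auto simp: half_L_def algebra_simps)

lemma half_M_lin: "half_M \<alpha> (\<lambda>i. s * x i + t * y i) = (\<lambda>i. s * half_M \<alpha> x i + t * half_M \<alpha> y i)"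
  by (auto simp: half_M_def algebra_simps)

lemma half_L_delta:
  assumes "even n"
  shows "half_L \<alpha> (delta n) = (\<lambda>m. cnj (\<alpha> n) * delta n m + rho (\<alpha> n) * delta (n + 1) m)"
    and "half_L \<alpha> (delta (n + 1)) = (\<lambda>m. rho (\<alpha> n) * delta n m - \<alpha> n * delta (n + 1) m)"
  using assms by (auto simp: half_L_def delta_def fun_eq_iff) presburger+

lemma half_M_delta:
  assumes "odd n"
  shows "half_M \<alpha> (delta n) = (\<lambda>m. cnj (\<alpha> n) * delta n m + rho (\<alpha> n) * delta (n + 1) m)"
    and "half_M \<alpha> (delta (n + 1)) = (\<lambda>m. rho (\<alpha> n) * delta n m - \<alpha> n * delta (n + 1) m)"
  using assms by (auto simp: half_M_def delta_def fun_eq_iff) presburger+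

lemma half_M_delta_0: "half_M \<alpha> (delta 0) = delta 0"
  by (auto simp: half_M_def delta_def fun_eq_iff)

lemma half_CMV_power_Suc: "(half_CMV \<alpha> ^^ Suc l) x = half_L \<alpha> (half_M \<alpha> ((half_CMV \<alpha> ^^ l) x))"
  by (simp add: half_CMV_def)

lemma half_ML_power_Suc:
  "(half_ML \<alpha> ^^ Suc l) x = half_M \<alpha> (half_L \<alpha> ((half_ML \<alpha> ^^ l) x))"
  by (simp add: half_ML_def)

section \<open>Growth of the support under powers\<close>

definition supp_le :: "(nat \<Rightarrow> complex) \<Rightarrow> nat \<Rightarrow> bool" where
  "supp_le v N \<longleftrightarrow> (\<forall>m>N. v m = 0)"

text \<open>A factor extends the support, by one coordinate, only if the last occupied coordinate is
  the first one of a block of that factor. This explains the parity cases here and below.\<close>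

lemma supp_half_L_even: "supp_le v (2 * N) \<Longrightarrow> supp_le (half_L \<alpha> v) (Suc (2 * N))"
  by (auto simp: supp_le_def half_L_def)

lemma supp_half_M_even: "supp_le v (2 * N) \<Longrightarrow> supp_le (half_M \<alpha> v) (2 * N)"
  unfolding supp_le_def half_M_def
  by (auto simp: Suc_lessI less_diff_conv)

lemma supp_half_M_odd: "supp_le v (Suc (2 * N)) \<Longrightarrow> supp_le (half_M \<alpha> v) (2 * Suc N)"
  by (auto simp: supp_le_def half_M_def)

lemma supp_half_CMV_power:
  "supp_le ((half_CMV \<alpha> ^^ Suc j) (delta 0)) (Suc (2 * j))"
  "supp_le (half_M \<alpha> ((half_CMV \<alpha> ^^ j) (delta 0))) (2 * j)"
proof -
  have L: "supp_le ((half_CMV \<alpha> ^^ Suc j) (delta 0)) (Suc (2 * j))"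
    if "supp_le (half_M \<alpha> ((half_CMV \<alpha> ^^ j) (delta 0))) (2 * j)" for j
    using supp_half_L_even[OF that] by (simp only: half_CMV_power_Suc)
  show M: "supp_le (half_M \<alpha> ((half_CMV \<alpha> ^^ j) (delta 0))) (2 * j)" for j
  proof (induction j)
    case 0
    show ?case by (auto simp: half_M_delta_0 supp_le_def) (auto simp: delta_def)
  next
    case (Suc j)
    from supp_half_M_odd[OF L[OF Suc]] show ?case .
  qed
  show "supp_le ((half_CMV \<alpha> ^^ Suc j) (delta 0)) (Suc (2 * j))"
    by (rule L[OF M])
qed

lemma supp_half_ML_power: "supp_le ((half_ML \<alpha> ^^ j) (delta 0)) (2 * j)"
proof (induction j)
  case 0
  show ?case by (auto simp: supp_le_def delta_def)
next
  case (Suc j)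
  from supp_half_M_odd[OF supp_half_L_even[OF Suc]] show ?case by (simp only: half_ML_power_Suc)
qed

lemma half_CMV_power_lin:
  "(half_CMV \<alpha> ^^ l) (\<lambda>i. s * x i + t * y i) = (\<lambda>i. s * (half_CMV \<alpha> ^^ l) x i + t * (half_CMV \<alpha> ^^ l) y i)"
  by (induction l) (simp_all add: half_CMV_power_Suc half_L_lin half_M_lin del: funpow.simps(2))

lemma half_ML_power_lin:
  "(half_ML \<alpha> ^^ l) (\<lambda>i. s * x i + t * y i) =
   (\<lambda>i. s * (half_ML \<alpha> ^^ l) x i + t * (half_ML \<alpha> ^^ l) y i)"
  by (induction l) (simp_all add: half_ML_power_Suc half_L_lin half_M_lin del: funpow.simps(2))

lemma cnj_half_CMV_power:
  "cnj ((half_CMV \<alpha> ^^ l) x n) = (half_CMV (\<lambda>n. cnj (\<alpha> n)) ^^ l) (\<lambda>i. cnj (x i)) n"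
proof (induction l arbitrary: n)
  case (Suc l)
  have "(\<lambda>n. cnj ((half_CMV \<alpha> ^^ l) x n)) = (half_CMV (\<lambda>n. cnj (\<alpha> n)) ^^ l) (\<lambda>i. cnj (x i))"
    using Suc by blast
  then have "(half_CMV (\<lambda>n. cnj (\<alpha> n)) ^^ Suc l) (\<lambda>i. cnj (x i)) n =
      half_L_inv \<alpha> (half_M_inv \<alpha> (\<lambda>n. cnj ((half_CMV \<alpha> ^^ l) x n))) n"
    by (simp only: half_CMV_power_Suc)
  also have "\<dots> = cnj (half_L \<alpha> (half_M \<alpha> ((half_CMV \<alpha> ^^ l) x)) n)"
    by (auto simp: half_L_def half_M_def)
  finally show ?case by (simp only: half_CMV_power_Suc)
qed simp

section \<open>The CMV basis\<close>

text \<open>The Szego recursion for the monic polynomials and their reversals, driven by the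
  coefficients alone. That they belong to \<mu> is shown in \<open>monic_OP_eq\<close>.\<close>

primrec szego :: "(nat \<Rightarrow> complex) \<Rightarrow> nat \<Rightarrow> complex poly \<times> complex poly" where
  "szego \<alpha> 0 = (1, 1)"
| "szego \<alpha> (Suc n) =
    (pCons 0 (fst (szego \<alpha> n)) - smult (cnj (\<alpha> n)) (snd (szego \<alpha> n)),
     snd (szego \<alpha> n) - smult (\<alpha> n) (pCons 0 (fst (szego \<alpha> n))))"

abbreviation "Phi \<alpha> n \<equiv> fst (szego \<alpha> n)"
abbreviation "Phis \<alpha> n \<equiv> snd (szego \<alpha> n)"

lemma degree_szego_le: "degree (Phi \<alpha> n) \<le> n \<and> degree (Phis \<alpha> n) \<le> n"
proof (induction n)
  case (Suc n)
  have "degree (pCons 0 (Phi \<alpha> n)) \<le> Suc n"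
    using Suc degree_pCons_le[of 0 "Phi \<alpha> n"] by linarith
  moreover have "degree (smult s p) \<le> Suc n" if "degree p \<le> Suc n" for s and p :: "complex poly"
    using that degree_smult_le le_trans by blast
  ultimately show ?case
    using Suc by (auto intro!: degree_diff_le)
qed simp

lemma coeff_Phi: "coeff (Phi \<alpha> n) n = 1"
proof (induction n)
  case (Suc n)
  have "coeff (Phis \<alpha> n) (Suc n) = 0"
    using degree_szego_le[of \<alpha> n] by (intro coeff_eq_0) auto
  then show ?case using Suc by simp
qed simp

lemma degree_Phi: "degree (Phi \<alpha> n) = n"
  using degree_szego_le[of \<alpha> n] le_degree[of "Phi \<alpha> n" n] coeff_Phi[of \<alpha> n] by auto

lemma Phis_circle:
  assumes "cmod z = 1"
  shows "poly (Phis \<alpha> n) z = z ^ n * cnj (poly (Phi \<alpha> n) z)"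
proof (induction n)
  case (Suc n)
  have z: "z * cnj z = 1" using assms by (simp add: complex_norm_square[symmetric])
  have "z ^ n * cnj (poly (Phis \<alpha> n) z) = (z * cnj z) ^ n * poly (Phi \<alpha> n) z"
    unfolding Suc by (simp add: power_mult_distrib)
  then have "z ^ n * cnj (poly (Phis \<alpha> n) z) = poly (Phi \<alpha> n) z" by (simp add: z)
  then have 1: "z * (\<alpha> n * (z ^ n * cnj (poly (Phis \<alpha> n) z))) = \<alpha> n * (z * poly (Phi \<alpha> n) z)" by simp
  have "z * cnj z * (z ^ n * cnj (poly (Phi \<alpha> n) z)) = poly (Phis \<alpha> n) z"
    using z Suc by simp
  then show ?case using 1 by (simp add: algebra_simps)
qed simp

text \<open>The reciprocal of the norm of \<open>Phi \<alpha> n\<close>, by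
  \<open>norm_Phi\<close>.\<close>

definition kappa :: "(nat \<Rightarrow> complex) \<Rightarrow> nat \<Rightarrow> real" where
  "kappa \<alpha> n = (\<Prod>j<n. 1 / sqrt (1 - (cmod (\<alpha> j))\<^sup>2))"

text \<open>\<open>chi\<close> is the CMV basis and \<open>chi_dual\<close> the alternate CMV basis. Negative powers of \<open>z\<close> are
  written as powers of \<open>cnj z\<close>, which keeps the functions continuous on the plane; the usual
  relations between the two bases then hold on the circle only, where they are conjugate.\<close>

definition chi :: "(nat \<Rightarrow> complex) \<Rightarrow> nat \<Rightarrow> complex \<Rightarrow> complex" where
  "chi \<alpha> n z = cnj z ^ (n div 2) * kappa \<alpha> n * poly (if even n then Phis \<alpha> n else Phi \<alpha> n) z"

definition chi_dual :: "(nat \<Rightarrow> complex) \<Rightarrow> nat \<Rightarrow> complex \<Rightarrow> complex" where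
  "chi_dual \<alpha> n z = cnj z ^ (Suc n div 2) * kappa \<alpha> n * poly (if even n then Phi \<alpha> n else Phis \<alpha> n) z"

lemma chi_0 [simp]: "chi \<alpha> 0 z = 1" "chi_dual \<alpha> 0 z = 1"
  by (simp_all add: chi_def chi_dual_def kappa_def)

lemma continuous_on_chi [continuous_intros]: "continuous_on S (chi \<alpha> n)" "continuous_on S (chi_dual \<alpha> n)"
  by (auto simp: chi_def[abs_def] chi_dual_def[abs_def] intro!: continuous_intros)

lemma continuous_on_half_L [continuous_intros]:
  assumes "\<And>n. continuous_on S (g n)"
  shows "continuous_on S (\<lambda>z. half_L \<alpha> (\<lambda>n. g n z) n)"
  by (cases "even n") (auto simp: half_L_def intro!: continuous_intros assms)

lemma continuous_on_half_M [continuous_intros]: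
  assumes "\<And>n. continuous_on S (g n)"
  shows "continuous_on S (\<lambda>z. half_M \<alpha> (\<lambda>n. g n z) n)"
  by (cases "n = 0"; cases "even n") (auto simp: half_M_def intro!: continuous_intros assms)

locale verblunsky =
  fixes \<alpha> :: "nat \<Rightarrow> complex"
  assumes lt1: "cmod (\<alpha> n) < 1"
begin

lemma le1: "cmod (\<alpha> n) \<le> 1"
  using lt1[of n] by simp

lemma rho_nz: "rho (\<alpha> n) \<noteq> 0"
  using lt1[of n] abs_square_less_1[of "cmod (\<alpha> n)"] by (simp add: rho_def)

lemma kappa_pos: "kappa \<alpha> n > 0"
  unfolding kappa_def using lt1 abs_square_less_1[of "cmod (\<alpha> _)"] by (intro prod_pos) simp

lemma kappa_Suc: "complex_of_real (kappa \<alpha> n) = rho (\<alpha> n) * complex_of_real (kappa \<alpha> (Suc n))"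
  using rho_nz[of n] by (simp add: kappa_def rho_def)

lemma rho2: "rho (\<alpha> n) * rho (\<alpha> n) = 1 - \<alpha> n * cnj (\<alpha> n)"
  by (rule rho_sq) (rule le1)

lemma chi_dual_mult_chi:
  assumes "cmod z = 1"
  shows "chi_dual \<alpha> n z * chi \<alpha> n z = complex_of_real ((kappa \<alpha> n)\<^sup>2 * (cmod (poly (Phi \<alpha> n) z))\<^sup>2)"
proof -
  have z: "cnj z * z = 1" using assms by (simp add: complex_norm_square[symmetric] mult.commute)
  have "n div 2 + Suc n div 2 = n" by presburger
  then have "cnj z ^ (n div 2) * cnj z ^ (Suc n div 2) = cnj z ^ n"
    by (metis power_add)
  then have "chi_dual \<alpha> n z * chi \<alpha> n z = cnj z ^ n * (kappa \<alpha> n)\<^sup>2 * (poly (Phi \<alpha> n) z * poly (Phis \<alpha> n) z)"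
    by (auto simp: chi_def chi_dual_def power2_eq_square algebra_simps)
  also have "\<dots> = (cnj z * z) ^ n * (kappa \<alpha> n)\<^sup>2 * (poly (Phi \<alpha> n) z * cnj (poly (Phi \<alpha> n) z))"
    unfolding Phis_circle[OF assms] by (simp add: power_mult_distrib mult_ac)
  finally show ?thesis by (simp add: z complex_norm_square[symmetric])
qed

text \<open>Here \<open>w\<close> stands for \<open>cnj z\<close>, \<open>W\<close> for its power
  \<open>n div 2\<close>, \<open>a\<close> and \<open>b\<close> for \<open>\<alpha> n\<close> and
  its conjugate, \<open>r\<close> for \<open>rho (\<alpha> n)\<close>, \<open>K\<close> for
  \<open>kappa \<alpha> (Suc n)\<close>, and \<open>P\<close>, \<open>Q\<close> for
  \<open>Phi \<alpha> n\<close>, \<open>Phis \<alpha> n\<close>.\<close>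

lemma szego_step_arith:
  fixes z w a b r K W P Q :: complex
  shows "z * w = 1 \<Longrightarrow> W * (r * K) * P = b * (w * W * (r * K) * Q) + r * (w * W * K * (z * P - b * Q))"
    and "r * r = 1 - a * b \<Longrightarrow> w * W * K * (Q - z * (a * P)) = r * (w * W * (r * K) * Q) - a * (w * W * K * (z * P - b * Q))"
    and "z * (W * (r * K) * P) = b * (W * (r * K) * Q) + r * (W * K * (z * P - b * Q))"
    and "z * w = 1 \<Longrightarrow> r * r = 1 - a * b \<Longrightarrow>
      z * (w * W * K * (Q - z * (a * P))) = r * (W * (r * K) * Q) - a * (W * K * (z * P - b * Q))"
  by algebra+

lemma chi_odd:
  assumes "odd n" "cmod z = 1"
  shows "chi \<alpha> n z = cnj (\<alpha> n) * chi_dual \<alpha> n z + rho (\<alpha> n) * chi_dual \<alpha> (n + 1) z"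
    and "chi \<alpha> (n + 1) z = rho (\<alpha> n) * chi_dual \<alpha> n z - \<alpha> n * chi_dual \<alpha> (n + 1) z"
proof -
  have z: "z * cnj z = 1" using assms by (simp add: complex_norm_square[symmetric])
  have k: "odd n" "Suc n div 2 = Suc (n div 2)" "Suc (Suc n) div 2 = Suc (n div 2)"
    using \<open>odd n\<close> by auto
  show "chi \<alpha> n z = cnj (\<alpha> n) * chi_dual \<alpha> n z + rho (\<alpha> n) * chi_dual \<alpha> (n + 1) z"
    unfolding chi_def chi_dual_def kappa_Suc[of n] by (simp add: k) (rule szego_step_arith(1)[OF z])
  show "chi \<alpha> (n + 1) z = rho (\<alpha> n) * chi_dual \<alpha> n z - \<alpha> n * chi_dual \<alpha> (n + 1) z"
    unfolding chi_def chi_dual_def kappa_Suc[of n] by (simp add: k) (rule szego_step_arith(2)[OF rho2])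
qed

lemma chi_dual_even:
  assumes "even n" "cmod z = 1"
  shows "z * chi_dual \<alpha> n z = cnj (\<alpha> n) * chi \<alpha> n z + rho (\<alpha> n) * chi \<alpha> (n + 1) z"
    and "z * chi_dual \<alpha> (n + 1) z = rho (\<alpha> n) * chi \<alpha> n z - \<alpha> n * chi \<alpha> (n + 1) z"
proof -
  have z: "z * cnj z = 1" using assms by (simp add: complex_norm_square[symmetric])
  have k: "even n" "Suc n div 2 = n div 2" "Suc (Suc n) div 2 = Suc (n div 2)"
    using \<open>even n\<close> by auto
  show "z * chi_dual \<alpha> n z = cnj (\<alpha> n) * chi \<alpha> n z + rho (\<alpha> n) * chi \<alpha> (n + 1) z"
    unfolding chi_def chi_dual_def kappa_Suc[of n] by (simp add: k) (rule szego_step_arith(3))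
  show "z * chi_dual \<alpha> (n + 1) z = rho (\<alpha> n) * chi \<alpha> n z - \<alpha> n * chi \<alpha> (n + 1) z"
    unfolding chi_def chi_dual_def kappa_Suc[of n] by (simp add: k) (rule szego_step_arith(4)[OF z rho2])
qed

lemma chi_eq_half_M:
  assumes "cmod z = 1"
  shows "chi \<alpha> n z = half_M \<alpha> (\<lambda>n. chi_dual \<alpha> n z) n"
  using chi_odd(1)[of n z] chi_odd(2)[of "n - 1" z] assms by (cases n) (auto simp: half_M_def)

lemma chi_dual_eq_half_L:
  assumes "cmod z = 1"
  shows "z * chi_dual \<alpha> n z = half_L \<alpha> (\<lambda>n. chi \<alpha> n z) n"
  using chi_dual_even(1)[of n z] chi_dual_even(2)[of "n - 1" z] assms by (cases n) (auto simp: half_L_def)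

text \<open>Cyclicity of \<open>delta 0\<close>, in dual form.\<close>

lemma cyclic:
  assumes "\<And>j. (half_CMV \<alpha> ^^ j) w 0 = 0" "\<And>j. (half_ML (\<lambda>n. cnj (\<alpha> n)) ^^ j) w 0 = 0"
  shows "w n = 0 \<and> half_M \<alpha> w n = 0"
  using assms
proof (induction n arbitrary: w)
  case 0
  then show ?case using "0.prems"(1)[of 0] by (simp add: half_M_def)
next
  case (Suc n)
  \<comment> \<open>The images of \<open>w\<close> under the matrix and its inverse inherit the
    hypotheses, since they only shift the exponent in the two-sided family of powers.\<close>
  define u where "u = half_CMV \<alpha> w"
  define v where "v = half_ML (\<lambda>n. cnj (\<alpha> n)) w"
  note inv = half_L_inv_left half_M_inv_left half_L_inv_right half_M_inv_right
  have iu: "half_ML (\<lambda>n. cnj (\<alpha> n)) u = w"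
    by (simp add: u_def half_CMV_def half_ML_def inv le1)
  have iv: "half_CMV \<alpha> v = w"
    by (simp add: v_def half_CMV_def half_ML_def inv le1)
  have w: "w n = 0" "half_M \<alpha> w n = 0"
    using Suc.IH[of w] Suc.prems by auto
  have u: "u n = 0"
  proof (rule Suc.IH[THEN conjunct1])
    show "(half_CMV \<alpha> ^^ j) u 0 = 0" for j
      using Suc.prems(1)[of "Suc j"] unfolding funpow_Suc_right u_def by simp
    show "(half_ML (\<lambda>n. cnj (\<alpha> n)) ^^ j) u 0 = 0" for j
    proof (cases j)
      case 0 then show ?thesis using Suc.prems(1)[of 1] by (simp add: u_def)
    next
      case (Suc i)
      then show ?thesis using iu Suc.prems(2)[of i] by (simp add: funpow_Suc_right del: funpow.simps)
    qed
  qed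
  have v: "half_M \<alpha> v n = 0"
  proof (rule Suc.IH[THEN conjunct2])
    show "(half_ML (\<lambda>n. cnj (\<alpha> n)) ^^ j) v 0 = 0" for j
      using Suc.prems(2)[of "Suc j"] unfolding funpow_Suc_right v_def by simp
    show "(half_CMV \<alpha> ^^ j) v 0 = 0" for j
    proof (cases j)
      case 0 then show ?thesis using Suc.prems(2)[of 1] by (simp add: v_def)
    next
      case (Suc i)
      then show ?thesis using iv Suc.prems(1)[of i] by (simp add: funpow_Suc_right del: funpow.simps)
    qed
  qed
  show ?case
  \<comment> \<open>A factor with a block at \<open>n\<close> whose input and output both vanish at
    \<open>n\<close> has input zero at \<open>n + 1\<close> as well, because
    \<open>rho (\<alpha> n)\<close> is nonzero.\<close>
  proof (cases "even n")
    case True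
    have "half_L \<alpha> (half_M \<alpha> w) n = 0" using u by (simp add: u_def half_CMV_def)
    then have 1: "half_M \<alpha> w (Suc n) = 0" using True w rho_nz[of n] by (simp add: half_L_def)
    have "half_L_inv \<alpha> w n = 0" using v by (simp add: v_def half_ML_def inv le1)
    then have "w (Suc n) = 0" using True w rho_nz[of n] by (simp add: half_L_def)
    with 1 show ?thesis by simp
  next
    case False
    then have "n \<noteq> 0" by (cases n) auto
    then have 1: "w (Suc n) = 0"
      using w False rho_nz[of n] by (simp add: half_M_def)
    then have "half_M \<alpha> w (Suc n) = 0" using w False by (simp add: half_M_def)
    with 1 show ?thesis by simp
  qed
qed

end

section \<open>The spectral measure in the CMV basis\<close>

locale cmv_measure = verblunsky +
  fixes \<mu> :: "complex measure"
  assumes spectral: "spectral_measure (half_CMV \<alpha>) (delta 0) \<mu>"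
begin

sublocale finite_measure \<mu>
  using spectral by (simp add: spectral_measure_def)

lemma sets_eq [measurable_cong]: "sets \<mu> = sets borel"
  using spectral by (simp add: spectral_measure_def)

lemma moment: "(\<integral>z. z ^ l \<partial>\<mu>) = (half_CMV \<alpha> ^^ l) (delta 0) 0"
  using spectral by (simp add: spectral_measure_def)

lemma AE_circle: "AE z in \<mu>. cmod z = 1"
proof (rule AE_I)
  show "{z \<in> space \<mu>. cmod z \<noteq> 1} \<subseteq> - sphere 0 1" by auto
  show "emeasure \<mu> (- sphere 0 1) = 0" "- sphere 0 1 \<in> sets \<mu>"
    using spectral by (auto simp: spectral_measure_def intro: open_Compl)
qed

lemma measurable_cont:
  fixes f :: "complex \<Rightarrow> 'b::real_normed_vector"
  shows "continuous_on UNIV f \<Longrightarrow> f \<in> borel_measurable \<mu>"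
  using borel_measurable_continuous_onI measurable_cong_sets[OF sets_eq refl] by blast

text \<open>A continuous function on the plane may be unbounded, but it is bounded on the compact
  circle that carries \<mu>.\<close>

lemma integrable_cont [intro]:
  fixes f :: "complex \<Rightarrow> complex"
  assumes "continuous_on UNIV f"
  shows "integrable \<mu> f"
proof -
  have "compact (f ` sphere 0 1)"
    by (intro compact_continuous_image continuous_on_subset[OF assms]) auto
  from compact_imp_bounded[OF this] obtain B where "\<forall>y\<in>f ` sphere 0 1. cmod y \<le> B"
    unfolding bounded_iff ..
  then have "\<And>z. cmod z = 1 \<Longrightarrow> cmod (f z) \<le> B" by simp
  then show ?thesis
    using AE_circle by (intro integrable_const_bound[where B = B] measurable_cont[OF assms]) auto
qed

lemma integral_circle_cong:
  fixes f g :: "complex \<Rightarrow> 'b::{banach,second_countable_topology}"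
  assumes "continuous_on UNIV f" "continuous_on UNIV g" "\<And>z. cmod z = 1 \<Longrightarrow> f z = g z"
  shows "(\<integral>z. f z \<partial>\<mu>) = (\<integral>z. g z \<partial>\<mu>)"
  by (rule integral_cong_AE) (use assms AE_circle in \<open>auto intro: measurable_cont\<close>)

text \<open>By conjugacy on the circle, \<open>cmv_coeff\<close> gives the coefficients in the basis \<open>chi\<close> and
  \<open>cmv_coeff_dual\<close> those in \<open>chi_dual\<close>; multiplication by \<open>z\<close> acts on the former as \<open>half_CMV\<close>.\<close>

definition cmv_coeff :: "(complex \<Rightarrow> complex) \<Rightarrow> nat \<Rightarrow> complex" where
  "cmv_coeff f n = (\<integral>z. chi_dual \<alpha> n z * f z \<partial>\<mu>)"

definition cmv_coeff_dual :: "(complex \<Rightarrow> complex) \<Rightarrow> nat \<Rightarrow> complex" where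
  "cmv_coeff_dual f n = (\<integral>z. chi \<alpha> n z * f z \<partial>\<mu>)"

lemma cmv_coeff_cong:
  assumes "continuous_on UNIV f" "continuous_on UNIV g" "\<And>z. cmod z = 1 \<Longrightarrow> f z = g z"
  shows "cmv_coeff f = cmv_coeff g" "cmv_coeff_dual f = cmv_coeff_dual g"
  unfolding cmv_coeff_def[abs_def] cmv_coeff_dual_def[abs_def]
  by (auto intro!: ext integral_circle_cong continuous_intros assms)

lemma integral_lin:
  fixes f g h :: "complex \<Rightarrow> complex"
  assumes [continuous_intros]: "continuous_on UNIV f" "continuous_on UNIV g" "continuous_on UNIV h"
  shows "(\<integral>z. (s * f z + t * g z) * h z \<partial>\<mu>) = s * (\<integral>z. f z * h z \<partial>\<mu>) + t * (\<integral>z. g z * h z \<partial>\<mu>)"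
proof -
  have "integrable \<mu> (\<lambda>z. f z * h z)" "integrable \<mu> (\<lambda>z. g z * h z)"
    by (auto intro!: continuous_intros)
  then show ?thesis
    by (simp add: algebra_simps)
qed

lemma cmv_coeff_lin:
  assumes "continuous_on UNIV f" "continuous_on UNIV g"
  shows "cmv_coeff (\<lambda>z. s * f z + t * g z) = (\<lambda>n. s * cmv_coeff f n + t * cmv_coeff g n)"
    and "cmv_coeff_dual (\<lambda>z. s * f z + t * g z) = (\<lambda>n. s * cmv_coeff_dual f n + t * cmv_coeff_dual g n)"
  using integral_lin[OF assms, of "chi_dual \<alpha> _"] integral_lin[OF assms, of "chi \<alpha> _"]
  by (auto simp: cmv_coeff_def[abs_def] cmv_coeff_dual_def[abs_def] mult.commute continuous_intros)

lemma cmv_coeff_dual_eq: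
  assumes f: "continuous_on UNIV f"
  shows "cmv_coeff_dual f = half_M \<alpha> (cmv_coeff f)"
proof
  fix n
  have "cmv_coeff_dual f n = (\<integral>z. half_M \<alpha> (\<lambda>n. chi_dual \<alpha> n z) n * f z \<partial>\<mu>)"
    unfolding cmv_coeff_dual_def
    by (rule integral_circle_cong)
      (auto intro!: continuous_intros f simp: chi_eq_half_M)
  also have "\<dots> = half_M \<alpha> (cmv_coeff f) n"
    using integral_lin[OF continuous_on_chi(2) continuous_on_chi(2) f, where t = "- _"]
      integral_lin[OF continuous_on_chi(2) continuous_on_chi(2) f]
    by (simp add: half_M_def cmv_coeff_def)
  finally show "cmv_coeff_dual f n = half_M \<alpha> (cmv_coeff f) n" .
qed

lemma cmv_coeff_times:
  assumes f: "continuous_on UNIV f"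
  shows "cmv_coeff (\<lambda>z. z * f z) = half_L \<alpha> (cmv_coeff_dual f)"
proof
  fix n
  have "cmv_coeff (\<lambda>z. z * f z) n = (\<integral>z. half_L \<alpha> (\<lambda>n. chi \<alpha> n z) n * f z \<partial>\<mu>)"
    unfolding cmv_coeff_def
    by (rule integral_circle_cong)
      (auto intro!: continuous_intros f simp: chi_dual_eq_half_L[symmetric])
  also have "\<dots> = half_L \<alpha> (cmv_coeff_dual f) n"
    using integral_lin[OF continuous_on_chi(1) continuous_on_chi(1) f, where t = "- _"]
      integral_lin[OF continuous_on_chi(1) continuous_on_chi(1) f]
    by (simp add: half_L_def cmv_coeff_dual_def)
  finally show "cmv_coeff (\<lambda>z. z * f z) n = half_L \<alpha> (cmv_coeff_dual f) n" .
qed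

lemma cmv_coeff_power:
  assumes f: "continuous_on UNIV f"
  shows "cmv_coeff (\<lambda>z. z ^ l * f z) = (half_CMV \<alpha> ^^ l) (cmv_coeff f)"
proof (induction l)
  case (Suc l)
  have g: "continuous_on UNIV (\<lambda>z. z ^ l * f z)" by (intro continuous_intros f)
  have "cmv_coeff (\<lambda>z. z ^ Suc l * f z) = cmv_coeff (\<lambda>z. z * (z ^ l * f z))"
    by (simp add: mult.assoc)
  also have "\<dots> = half_L \<alpha> (half_M \<alpha> (cmv_coeff (\<lambda>z. z ^ l * f z)))"
    by (simp only: cmv_coeff_times[OF g] cmv_coeff_dual_eq[OF g])
  finally show ?case by (simp only: Suc half_CMV_power_Suc)
qed simp

text \<open>On the circle, multiplication by \<open>cnj z\<close> inverts multiplication by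
  \<open>z\<close>, so it acts as the inverse matrix, which is \<open>half_ML\<close> with conjugate
  coefficients.\<close>

lemma cmv_coeff_cnj_power:
  assumes f: "continuous_on UNIV f"
  shows "cmv_coeff (\<lambda>z. cnj z ^ l * f z) = (half_ML (\<lambda>n. cnj (\<alpha> n)) ^^ l) (cmv_coeff f)"
proof (induction l)
  case (Suc l)
  define g where "g = (\<lambda>z. cnj z ^ Suc l * f z)"
  have g: "continuous_on UNIV g" unfolding g_def by (intro continuous_intros f)
  have "cmv_coeff (\<lambda>z. cnj z ^ l * f z) = cmv_coeff (\<lambda>z. z * g z)"
  proof (rule cmv_coeff_cong)
    fix z :: complex assume "cmod z = 1"
    then have z: "z * cnj z = 1" by (simp add: complex_norm_square[symmetric])
    have "z * g z = (z * cnj z) * (cnj z ^ l * f z)" by (simp add: g_def mult_ac)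
    then show "cnj z ^ l * f z = z * g z" by (simp add: z)
  qed (use f g in \<open>auto intro!: continuous_intros\<close>)
  also have "\<dots> = half_L \<alpha> (half_M \<alpha> (cmv_coeff g))"
    by (simp only: cmv_coeff_times[OF g] cmv_coeff_dual_eq[OF g])
  finally have "cmv_coeff g = half_M_inv \<alpha> (half_L_inv \<alpha> (cmv_coeff (\<lambda>z. cnj z ^ l * f z)))"
    by (simp add: half_L_inv_left half_M_inv_left le1)
  then show ?case by (simp only: Suc half_ML_power_Suc g_def)
qed simp

lemma cmv_coeff_one: "cmv_coeff (\<lambda>z. 1) = delta 0"
proof -
  define w where "w = (\<lambda>n. 1 * cmv_coeff (\<lambda>z. 1) n + (- 1) * delta 0 n)"
  have "w n = 0 \<and> half_M \<alpha> w n = 0" for n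
  proof (rule cyclic)
    fix j
    have "(half_CMV \<alpha> ^^ j) (cmv_coeff (\<lambda>z. 1)) 0 = (\<integral>z. z ^ j \<partial>\<mu>)"
      by (subst cmv_coeff_power[symmetric]) (auto simp: cmv_coeff_def)
    then show "(half_CMV \<alpha> ^^ j) w 0 = 0"
      by (simp only: w_def half_CMV_power_lin) (simp add: moment)
    have "(half_ML (\<lambda>n. cnj (\<alpha> n)) ^^ j) (cmv_coeff (\<lambda>z. 1)) 0 = (\<integral>z. cnj (z ^ j) \<partial>\<mu>)"
      by (subst cmv_coeff_cnj_power[symmetric]) (auto simp: cmv_coeff_def)
    also have "\<dots> = cnj ((half_CMV \<alpha> ^^ j) (delta 0) 0)"
      by (simp only: Bochner_Integration.integral_cnj moment)
    also have "\<dots> = (half_ML (\<lambda>n. cnj (\<alpha> n)) ^^ j) (delta 0) 0"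
      by (simp only: cnj_half_CMV_power half_LM_ML) (simp add: delta_def if_distrib cong: if_cong)
    finally show "(half_ML (\<lambda>n. cnj (\<alpha> n)) ^^ j) w 0 = 0"
      by (simp only: w_def half_ML_power_lin) simp
  qed
  then show ?thesis by (auto simp: w_def fun_eq_iff)
qed

text \<open>Biorthogonality of \<open>chi\<close> and \<open>chi_dual\<close>, on the circle the
  orthonormality of each. The relations of the block at \<open>n\<close> are solved for the next
  pair: one member by dividing by \<open>rho (\<alpha> n)\<close>, the other by inverting the
  factor.\<close>

lemma cmv_coeff_chi: "cmv_coeff (chi \<alpha> n) = delta n \<and> cmv_coeff_dual (chi_dual \<alpha> n) = delta n"
proof (induction n)
  case 0
  have "cmv_coeff (chi \<alpha> 0) = delta 0"
    using cmv_coeff_one by (simp add: cmv_coeff_def[abs_def])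
  moreover have "cmv_coeff_dual (chi_dual \<alpha> 0) = half_M \<alpha> (cmv_coeff (\<lambda>z. 1))"
    by (subst cmv_coeff_dual_eq[symmetric]) (simp_all add: cmv_coeff_dual_def[abs_def])
  ultimately show ?case by (simp only: cmv_coeff_one half_M_delta_0 simp_thms)
next
  case (Suc n)
  have cont: "continuous_on UNIV (\<lambda>z. s * f z + t * g z)" if "continuous_on UNIV f" "continuous_on UNIV g"
    for s t and f g :: "complex \<Rightarrow> complex" using that by (intro continuous_intros)
  have contz: "continuous_on UNIV (\<lambda>z. z * f z)" if "continuous_on UNIV f"
    for f :: "complex \<Rightarrow> complex" using that by (intro continuous_intros)
  note chi = continuous_on_chi
  show ?case
  proof (cases "even n")
    case True
    have "half_L \<alpha> (delta n) = half_L \<alpha> (cmv_coeff_dual (chi_dual \<alpha> n))" using Suc by simp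
    also have "\<dots> = cmv_coeff (\<lambda>z. z * chi_dual \<alpha> n z)"
      by (simp add: cmv_coeff_times chi)
    also have "\<dots> = cmv_coeff (\<lambda>z. cnj (\<alpha> n) * chi \<alpha> n z + rho (\<alpha> n) * chi \<alpha> (n + 1) z)"
      by (rule cmv_coeff_cong(1)[OF contz cont]) (rule chi | simp add: chi_dual_even(1)[OF True, simplified])+
    also have "\<dots> = (\<lambda>m. cnj (\<alpha> n) * delta n m + rho (\<alpha> n) * cmv_coeff (chi \<alpha> (n + 1)) m)"
      using Suc by (simp add: cmv_coeff_lin chi)
    finally have 1: "cmv_coeff (chi \<alpha> (n + 1)) = delta (n + 1)"
      using rho_nz[of n] unfolding half_L_delta(1)[OF True] by (auto simp: fun_eq_iff)
    have "half_L \<alpha> (cmv_coeff_dual (chi_dual \<alpha> (n + 1))) = cmv_coeff (\<lambda>z. z * chi_dual \<alpha> (n + 1) z)"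
      by (simp add: cmv_coeff_times chi)
    also have "\<dots> = cmv_coeff (\<lambda>z. rho (\<alpha> n) * chi \<alpha> n z + (- \<alpha> n) * chi \<alpha> (n + 1) z)"
      by (rule cmv_coeff_cong(1)[OF contz cont]) (rule chi | simp add: chi_dual_even(2)[OF True, simplified])+
    also have "\<dots> = (\<lambda>m. rho (\<alpha> n) * delta n m + (- \<alpha> n) * delta (n + 1) m)"
      unfolding cmv_coeff_lin[OF chi(1) chi(1)] using Suc 1 by simp
    also have "\<dots> = half_L \<alpha> (delta (n + 1))"
      unfolding half_L_delta(2)[OF True] by simp
    finally have "half_L_inv \<alpha> (half_L \<alpha> (cmv_coeff_dual (chi_dual \<alpha> (n + 1)))) = half_L_inv \<alpha> (half_L \<alpha> (delta (n + 1)))"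
      by simp
    then show ?thesis using 1 by (simp add: half_L_inv_left le1)
  next
    case False
    have "half_M \<alpha> (delta n) = half_M \<alpha> (cmv_coeff (chi \<alpha> n))" using Suc by simp
    also have "\<dots> = cmv_coeff_dual (chi \<alpha> n)"
      by (simp add: cmv_coeff_dual_eq chi)
    also have "\<dots> = cmv_coeff_dual (\<lambda>z. cnj (\<alpha> n) * chi_dual \<alpha> n z + rho (\<alpha> n) * chi_dual \<alpha> (n + 1) z)"
      by (rule cmv_coeff_cong(2)[OF chi(1) cont]) (rule chi | simp add: chi_odd(1)[OF False, simplified])+
    also have "\<dots> = (\<lambda>m. cnj (\<alpha> n) * delta n m + rho (\<alpha> n) * cmv_coeff_dual (chi_dual \<alpha> (n + 1)) m)"
      using Suc by (simp add: cmv_coeff_lin chi)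
    finally have 1: "cmv_coeff_dual (chi_dual \<alpha> (n + 1)) = delta (n + 1)"
      using rho_nz[of n] unfolding half_M_delta(1)[OF False] by (auto simp: fun_eq_iff)
    have "half_M \<alpha> (cmv_coeff (chi \<alpha> (n + 1))) = cmv_coeff_dual (chi \<alpha> (n + 1))"
      by (simp add: cmv_coeff_dual_eq chi)
    also have "\<dots> = cmv_coeff_dual (\<lambda>z. rho (\<alpha> n) * chi_dual \<alpha> n z + (- \<alpha> n) * chi_dual \<alpha> (n + 1) z)"
      by (rule cmv_coeff_cong(2)[OF chi(1) cont]) (rule chi | simp add: chi_odd(2)[OF False, simplified])+
    also have "\<dots> = (\<lambda>m. rho (\<alpha> n) * delta n m + (- \<alpha> n) * delta (n + 1) m)"
      unfolding cmv_coeff_lin[OF chi(2) chi(2)] using Suc 1 by simp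
    also have "\<dots> = half_M \<alpha> (delta (n + 1))"
      unfolding half_M_delta(2)[OF False] by simp
    finally have "half_M_inv \<alpha> (half_M \<alpha> (cmv_coeff (chi \<alpha> (n + 1)))) = half_M_inv \<alpha> (half_M \<alpha> (delta (n + 1)))"
      by simp
    then show ?thesis using 1 by (simp add: half_M_inv_left le1)
  qed
qed

lemma integral_power_Phi:
  "(\<integral>z. complex_of_real ((kappa \<alpha> n)\<^sup>2 * (cmod (poly (Phi \<alpha> n) z))\<^sup>2) * z ^ l \<partial>\<mu>) = (half_CMV \<alpha> ^^ l) (delta n) n"
proof -
  have "(half_CMV \<alpha> ^^ l) (delta n) n = cmv_coeff (\<lambda>z. z ^ l * chi \<alpha> n z) n"
    by (simp only: cmv_coeff_power[OF continuous_on_chi(1)] cmv_coeff_chi)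
  also have "\<dots> = (\<integral>z. complex_of_real ((kappa \<alpha> n)\<^sup>2 * (cmod (poly (Phi \<alpha> n) z))\<^sup>2) * z ^ l \<partial>\<mu>)"
    unfolding cmv_coeff_def
    by (rule integral_circle_cong)
      (auto intro!: continuous_intros simp: chi_dual_mult_chi[symmetric] simp del: of_real_mult of_real_power)
  finally show ?thesis by simp
qed

text \<open>The light cone of \<open>half_CMV\<close> started at \<open>delta 0\<close> has not reached \<open>n\<close>.\<close>

lemma cmv_coeff_shift:
  assumes "m < n"
  shows "even n \<Longrightarrow> cmv_coeff (\<lambda>z. z ^ (n div 2) * cnj z ^ m) n = 0"
    and "odd n \<Longrightarrow> cmv_coeff_dual (\<lambda>z. z ^ (n div 2) * cnj z ^ m) n = 0"
proof -
  define k where "k = n div 2"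
  define f where "f = (\<lambda>z::complex. z ^ k * cnj z ^ m)"
  have f: "continuous_on UNIV f" unfolding f_def by (intro continuous_intros)
  \<comment> \<open>On the circle \<open>f\<close> is \<open>z ^ (k - m)\<close> or
    \<open>cnj z ^ (m - k)\<close>, so its coefficients are a power of the matrix or of its inverse
    applied to \<open>delta 0\<close>.\<close>
  have *: "(even n \<longrightarrow> cmv_coeff f n = 0) \<and> (odd n \<longrightarrow> half_M \<alpha> (cmv_coeff f) n = 0)"
  proof (cases "m \<le> k")
    case True
    have "cmv_coeff f = cmv_coeff (\<lambda>z. z ^ (k - m) * 1)"
    proof (rule cmv_coeff_cong(1)[OF f])
      fix z :: complex assume "cmod z = 1"
      then have z: "z * cnj z = 1" by (simp add: complex_norm_square[symmetric])
      have "f z = z ^ (k - m) * (z * cnj z) ^ m"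
        using True by (simp add: f_def power_mult_distrib mult.assoc[symmetric] flip: power_add)
      then show "f z = z ^ (k - m) * 1" by (simp add: z)
    qed (intro continuous_intros)
    then have eq: "cmv_coeff f = (half_CMV \<alpha> ^^ (k - m)) (delta 0)"
      by (simp only: cmv_coeff_power[OF continuous_on_const] cmv_coeff_one)
    have "cmv_coeff f n = 0" if "even n"
    proof (cases "k - m")
      case 0
      then show ?thesis using assms by (simp add: eq delta_def)
    next
      case (Suc j)
      then have "Suc (2 * j) < n" using \<open>even n\<close> by (auto simp: k_def)
      then show ?thesis using supp_half_CMV_power(1)[of j \<alpha>] by (simp only: eq Suc supp_le_def)
    qed
    moreover have "half_M \<alpha> (cmv_coeff f) n = 0" if "odd n"
    proof -
      have "2 * (k - m) < n" using that assms by (auto simp: k_def elim!: oddE)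
      then show ?thesis using supp_half_CMV_power(2)[of \<alpha> "k - m"] by (simp only: eq supp_le_def)
    qed
    ultimately show ?thesis by blast
  next
    case False
    have "cmv_coeff f = cmv_coeff (\<lambda>z. cnj z ^ (m - k) * 1)"
    proof (rule cmv_coeff_cong(1)[OF f])
      fix z :: complex assume "cmod z = 1"
      then have z: "z * cnj z = 1" by (simp add: complex_norm_square[symmetric])
      have "f z = (z * cnj z) ^ k * cnj z ^ (m - k)"
        using False by (simp add: f_def power_mult_distrib mult.assoc flip: power_add)
      then show "f z = cnj z ^ (m - k) * 1" by (simp add: z)
    qed (intro continuous_intros)
    then have eq: "cmv_coeff f = (half_ML (\<lambda>n. cnj (\<alpha> n)) ^^ (m - k)) (delta 0)"
      by (simp only: cmv_coeff_cnj_power[OF continuous_on_const] cmv_coeff_one)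
    have s: "supp_le (cmv_coeff f) (2 * (m - k))" unfolding eq by (rule supp_half_ML_power)
    have "2 * (m - k) < n" using assms False by (auto simp: k_def)
    then show ?thesis using s supp_half_M_even[OF s, of \<alpha>] by (simp add: supp_le_def)
  qed
  then show "even n \<Longrightarrow> cmv_coeff (\<lambda>z. z ^ (n div 2) * cnj z ^ m) n = 0"
    "odd n \<Longrightarrow> cmv_coeff_dual (\<lambda>z. z ^ (n div 2) * cnj z ^ m) n = 0"
    using cmv_coeff_dual_eq[OF f] by (simp_all add: f_def k_def)
qed

section \<open>Orthogonal polynomials and the moments of their measures\<close>

lemma Phi_orthogonal:
  assumes "m < n"
  shows "(\<integral>z. cnj (z ^ m) * poly (Phi \<alpha> n) z \<partial>\<mu>) = 0"
proof -
  \<comment> \<open>The basis function built from \<open>Phi\<close> rather than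
    \<open>Phis\<close>. On the circle \<open>Phi\<close> is a multiple of
    \<open>g z * z ^ (n div 2)\<close>, which turns the claim into the vanishing of an
    \<open>n\<close>-th coefficient.\<close>
  define g where "g = (if even n then chi_dual \<alpha> n else chi \<alpha> n)"
  have g: "continuous_on UNIV g" by (simp add: g_def continuous_on_chi)
  have P: "poly (Phi \<alpha> n) z = (1 / kappa \<alpha> n) * (g z * z ^ (n div 2))" if "cmod z = 1" for z
  proof -
    have z: "cnj z * z = 1" using that by (simp add: complex_norm_square[symmetric] mult.commute)
    have "g z = cnj z ^ (n div 2) * kappa \<alpha> n * poly (Phi \<alpha> n) z"
      by (auto simp: g_def chi_def chi_dual_def)
    then have "g z * z ^ (n div 2) = (cnj z * z) ^ (n div 2) * (kappa \<alpha> n * poly (Phi \<alpha> n) z)"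
      by (simp add: power_mult_distrib mult_ac)
    then show ?thesis using kappa_pos[of n] by (simp add: z)
  qed
  have "(\<integral>z. cnj (z ^ m) * poly (Phi \<alpha> n) z \<partial>\<mu>) = (\<integral>z. (1 / kappa \<alpha> n) * (g z * (z ^ (n div 2) * cnj z ^ m)) \<partial>\<mu>)"
    by (rule integral_circle_cong) (auto intro!: continuous_intros g simp: P kappa_pos[THEN less_imp_neq, symmetric])
  also have "\<dots> = (1 / kappa \<alpha> n) * (\<integral>z. g z * (z ^ (n div 2) * cnj z ^ m) \<partial>\<mu>)"
    by (rule integral_mult_right_zero)
  also have "(\<integral>z. g z * (z ^ (n div 2) * cnj z ^ m) \<partial>\<mu>) = 0"
    using cmv_coeff_shift[OF assms] by (auto simp: g_def cmv_coeff_def cmv_coeff_dual_def)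
  finally show ?thesis by simp
qed

lemma norm_Phi: "(\<integral>z. (cmod (poly (Phi \<alpha> n) z))\<^sup>2 \<partial>\<mu>) = 1 / (kappa \<alpha> n)\<^sup>2"
proof -
  have "complex_of_real (\<integral>z. (kappa \<alpha> n)\<^sup>2 * (cmod (poly (Phi \<alpha> n) z))\<^sup>2 \<partial>\<mu>) =
      (\<integral>z. complex_of_real ((kappa \<alpha> n)\<^sup>2 * (cmod (poly (Phi \<alpha> n) z))\<^sup>2) * z ^ 0 \<partial>\<mu>)"
    by (simp only: integral_complex_of_real power_0 mult_1_right)
  also have "\<dots> = 1"
    by (simp only: integral_power_Phi) (simp add: delta_def)
  finally have "(kappa \<alpha> n)\<^sup>2 * (\<integral>z. (cmod (poly (Phi \<alpha> n) z))\<^sup>2 \<partial>\<mu>) = 1"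
    by (simp only: integral_mult_right_zero of_real_eq_1_iff)
  then show ?thesis using kappa_pos[of n] by (simp add: field_simps)
qed

lemma integral_cnj_poly:
  assumes f: "continuous_on UNIV f"
  shows "(\<integral>z. cnj (poly p z) * f z \<partial>\<mu>) = (\<Sum>m\<le>degree p. cnj (coeff p m) * (\<integral>z. cnj (z ^ m) * f z \<partial>\<mu>))"
proof -
  have i: "integrable \<mu> (\<lambda>z. cnj (coeff p m) * (cnj (z ^ m) * f z))" for m
    by (intro integrable_cont continuous_intros f)
  have "(\<integral>z. cnj (poly p z) * f z \<partial>\<mu>) = (\<integral>z. (\<Sum>m\<le>degree p. cnj (coeff p m) * (cnj (z ^ m) * f z)) \<partial>\<mu>)"
    by (simp add: poly_altdef sum_distrib_right mult.assoc)
  also have "\<dots> = (\<Sum>m\<le>degree p. \<integral>z. cnj (coeff p m) * (cnj (z ^ m) * f z) \<partial>\<mu>)"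
    using i by (rule Bochner_Integration.integral_sum)
  finally show ?thesis by (simp only: integral_mult_right_zero)
qed

text \<open>For uniqueness, a second candidate differs from \<open>Phi \<alpha> n\<close> by some
  \<open>r\<close> of degree \<open>d < n\<close> that is orthogonal to all powers below
  \<open>n\<close>. Pairing a nonzero \<open>r\<close> with \<open>Phi \<alpha> d\<close> isolates
  its leading coefficient times the positive squared norm of \<open>Phi \<alpha> d\<close>.\<close>

lemma monic_OP_eq: "monic_OP \<mu> n = Phi \<alpha> n"
  unfolding monic_OP_def
proof (rule the_equality, goal_cases)
  case 1
  show ?case using Phi_orthogonal by (simp add: degree_Phi coeff_Phi)
next
  case (2 p)
  define r where "r = p - Phi \<alpha> n"
  have cp: "continuous_on UNIV (poly q)" for q :: "complex poly" by (intro continuous_intros)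
  have orth: "(\<integral>z. cnj (z ^ m) * poly r z \<partial>\<mu>) = 0" if "m < n" for m
  proof -
    have "(\<integral>z. cnj (z ^ m) * poly r z \<partial>\<mu>) = (\<integral>z. cnj (z ^ m) * poly p z - cnj (z ^ m) * poly (Phi \<alpha> n) z \<partial>\<mu>)"
      by (simp add: r_def algebra_simps)
    also have "\<dots> = 0"
      using 2 that Phi_orthogonal[OF that]
      by (subst Bochner_Integration.integral_diff) (auto intro!: integrable_cont continuous_intros)
    finally show ?thesis .
  qed
  have "r = 0"
  proof (rule ccontr)
    assume r: "r \<noteq> 0"
    define d where "d = degree r"
    have "coeff r n = 0" using 2 coeff_Phi[of \<alpha> n] by (auto simp: r_def)
    moreover have "degree r \<le> n" unfolding r_def by (rule degree_diff_le) (use 2 degree_Phi[of \<alpha> n] in auto)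
    ultimately have d: "d < n" using r unfolding d_def by (metis leading_coeff_0_iff nat_less_le)
    have "(\<integral>z. cnj (poly (Phi \<alpha> d) z) * poly r z \<partial>\<mu>) = 0"
      unfolding integral_cnj_poly[OF cp] degree_Phi
      by (rule sum.neutral) (use d in \<open>auto simp del: complex_cnj_power intro!: orth\<close>)
    then have "0 = cnj (\<integral>z. cnj (poly (Phi \<alpha> d) z) * poly r z \<partial>\<mu>)" by simp
    also have "\<dots> = (\<integral>z. cnj (poly r z) * poly (Phi \<alpha> d) z \<partial>\<mu>)"
      by (simp add: mult.commute flip: Bochner_Integration.integral_cnj)
    also have "\<dots> = (\<Sum>m\<le>d. cnj (coeff r m) * (\<integral>z. cnj (z ^ m) * poly (Phi \<alpha> d) z \<partial>\<mu>))"
      unfolding d_def by (rule integral_cnj_poly[OF cp])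
    also have "\<dots> = cnj (coeff r d) * (\<integral>z. cnj (z ^ d) * poly (Phi \<alpha> d) z \<partial>\<mu>)"
      using Phi_orthogonal[of _ d] by (simp add: lessThan_Suc_atMost[symmetric] del: complex_cnj_power)
    finally have 1: "(\<integral>z. cnj (z ^ d) * poly (Phi \<alpha> d) z \<partial>\<mu>) = 0"
      using r by (simp add: d_def del: complex_cnj_power)
    have "complex_of_real (\<integral>z. (cmod (poly (Phi \<alpha> d) z))\<^sup>2 \<partial>\<mu>) = (\<integral>z. cnj (poly (Phi \<alpha> d) z) * poly (Phi \<alpha> d) z \<partial>\<mu>)"
      by (simp only: integral_complex_of_real[symmetric] complex_norm_square mult.commute[of "cnj _"])
    also have "\<dots> = (\<integral>z. cnj (z ^ d) * poly (Phi \<alpha> d) z \<partial>\<mu>)"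
      using Phi_orthogonal[of _ d] coeff_Phi[of \<alpha> d]
      by (simp add: integral_cnj_poly[OF cp] degree_Phi lessThan_Suc_atMost[symmetric] del: complex_cnj_power)
    finally show False using 1 norm_Phi[of d] kappa_pos[of d] by simp
  qed
  then show ?case by (simp add: r_def)
qed

lemma OP_measure_eq:
  "OP_measure \<mu> n = density \<mu> (\<lambda>z. ennreal ((kappa \<alpha> n)\<^sup>2 * (cmod (poly (Phi \<alpha> n) z))\<^sup>2))"
  using kappa_pos[of n]
  by (simp add: OP_measure_def orthonormal_OP_def monic_OP_eq norm_Phi real_sqrt_divide norm_mult power_mult_distrib)

lemma OP_measure_moment: "(\<integral>z. z ^ l \<partial>OP_measure \<mu> n) = (half_CMV \<alpha> ^^ l) (delta n) n"
proof -
  have "(\<integral>z. z ^ l \<partial>OP_measure \<mu> n) = (\<integral>z. ((kappa \<alpha> n)\<^sup>2 * (cmod (poly (Phi \<alpha> n) z))\<^sup>2) *\<^sub>R z ^ l \<partial>\<mu>)"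
    unfolding OP_measure_eq
    by (rule integral_density) (auto intro!: measurable_cont continuous_intros)
  then show ?thesis by (simp only: scaleR_conv_of_real integral_power_Phi)
qed

lemma sets_OP_measure [measurable_cong]: "sets (OP_measure \<mu> n) = sets borel"
  by (simp add: OP_measure_def sets_eq)

lemma AE_OP_measure: "AE z in OP_measure \<mu> n. cmod z = 1"
  unfolding OP_measure_eq
  by (subst AE_density) (use AE_circle in \<open>auto intro!: measurable_compose[OF _ measurable_ennreal] measurable_cont continuous_intros\<close>)

lemma prob_space_OP_measure: "prob_space (OP_measure \<mu> n)"
proof
  have "complex_of_real (measure (OP_measure \<mu> n) (space (OP_measure \<mu> n))) = 1"
    using OP_measure_moment[where l = 0 and n = n] by (simp add: delta_def scaleR_conv_of_real)
  then have "measure (OP_measure \<mu> n) (space (OP_measure \<mu> n)) = 1"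
    using of_real_eq_1_iff by blast
  \<comment> \<open>\<open>measure\<close> would return 0 on infinite mass, so the value 1 also
    gives finiteness.\<close>
  then show "emeasure (OP_measure \<mu> n) (space (OP_measure \<mu> n)) = 1"
    by (metis emeasure_eq_ennreal_measure ennreal_1 enn2real_top measure_def zero_neq_one)
qed

end

section \<open>Limits of measures on the circle\<close>

text \<open>\<open>Arg\<close> is continuous off the nonpositive real axis and equal to
  \<open>pi\<close> on it, except for the convention \<open>Arg 0 = 0\<close>.\<close>

lemma borel_measurable_Arg: "Arg \<in> borel_measurable borel"
proof -
  have "(\<lambda>z. if z \<in> - \<real>\<^sub>\<le>\<^sub>0 then Arg z else pi) \<in> borel_measurable borel"
    by (rule borel_measurable_continuous_on_if)
      (auto intro!: borel_open continuous_at_imp_continuous_on continuous_at_Arg simp: open_Compl)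
  then have "(\<lambda>z. if z = 0 then 0 else if z \<in> - \<real>\<^sub>\<le>\<^sub>0 then Arg z else pi) \<in> borel_measurable borel"
    by (rule measurable_If[rotated]) auto
  also have "(\<lambda>z. if z = 0 then 0 else if z \<in> - \<real>\<^sub>\<le>\<^sub>0 then Arg z else pi) = Arg"
  proof
    fix z
    have "Arg z = pi" if "z \<in> \<real>\<^sub>\<le>\<^sub>0" "z \<noteq> 0"
      using that by (auto simp: Arg_eq_pi complex_nonpos_Reals_iff complex_eq_iff)
    then show "(if z = 0 then 0 else if z \<in> - \<real>\<^sub>\<le>\<^sub>0 then Arg z else pi) = Arg z"
      by (simp add: Arg_zero)
  qed
  finally show ?thesis .
qed

text \<open>Helly selection is available on the line only, so the circle is cut open by \<open>Arg\<close>.\<close>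

lemma circle_measure_limit:
  fixes P :: "nat \<Rightarrow> complex measure" and m :: "nat \<Rightarrow> complex"
  assumes P: "\<And>j. prob_space (P j)" "\<And>j. sets (P j) = sets borel" "\<And>j. AE z in P j. cmod z = 1"
    and lim: "\<And>l. (\<lambda>j. \<integral>z. z ^ l \<partial>P j) \<longlonglongrightarrow> m l"
  shows "\<exists>nu. finite_measure nu \<and> sets nu = sets borel \<and> emeasure nu (- sphere 0 1) = 0 \<and>
    (\<forall>l. (\<integral>z. z ^ l \<partial>nu) = m l)"
proof -
  have Arg: "Arg \<in> borel_measurable borel" by (rule borel_measurable_Arg)
  define Q where "Q = (\<lambda>j. distr (P j) borel Arg)"
  have Arg_P: "Arg \<in> borel_measurable (P j)" for j
    using Arg measurable_cong_sets[OF P(2) refl] by blast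
  have Q: "real_distribution (Q j)" for j
    unfolding Q_def using P(1) Arg_P by (intro prob_space.real_distribution_distr)
  have tight: "tight Q"
    unfolding tight_def
  proof (intro conjI allI impI Q)
    fix \<epsilon> :: real assume "\<epsilon> > 0"
    \<comment> \<open>Values of \<open>Arg\<close> lie between \<open>- pi\<close> and
      \<open>pi\<close>, and \<open>pi < 4\<close>, so one bounded interval carries all the
      mass.\<close>
    have "measure (Q j) {-4<..4} = 1" for j
    proof -
      interpret real_distribution "Q j" by (rule Q)
      have "x \<in> {-4<..4}" if "x = Arg z" for x z
        using that Arg_bounded[of z] pi_less_4 by auto
      then have "AE x in Q j. x \<in> {-4<..4}"
        unfolding Q_def by (subst AE_distr_iff) (use Arg_P in auto)
      then show ?thesis by (intro prob_eq_1[THEN iffD2]) auto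
    qed
    then show "\<exists>a b. a < b \<and> (\<forall>n. 1 - \<epsilon> < measure (Q n) {a<..b})"
      using \<open>\<epsilon> > 0\<close> by (intro exI[of _ "-4"] exI[of _ 4]) simp
  qed
  from tight_imp_convergent_subsubsequence[OF tight strict_mono_id] obtain r M where
    r: "strict_mono (r :: nat \<Rightarrow> nat)" and M: "real_distribution M" and conv: "weak_conv_m (Q \<circ> r) M"
    by auto
  interpret M: real_distribution M by (rule M)
  have cis: "cis \<in> borel_measurable M"
  proof -
    have "(\<lambda>x. exp (\<i> * complex_of_real x)) \<in> borel_measurable borel"
      by (intro borel_measurable_continuous_onI continuous_intros)
    then show ?thesis
      using measurable_cong_sets[OF M.events_eq_borel refl] by (simp flip: cis_conv_exp)
  qed
  \<comment> \<open>Wrapping the line back onto the circle. \<open>M\<close> comes from a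
    subsequence, but its characteristic function at the natural numbers is the limit of the given
    moments, so no further convergence is required.\<close>
  define nu where "nu = distr M borel cis"
  have "finite_measure nu"
    unfolding nu_def by (intro M.finite_measure_distr cis)
  moreover have "emeasure nu (- sphere 0 1) = 0"
  proof -
    have "cis -` (- sphere 0 1) \<inter> space M = {}" by auto
    then show ?thesis
      unfolding nu_def by (subst emeasure_distr) (auto intro!: cis open_Compl)
  qed
  moreover have "(\<integral>z. z ^ l \<partial>nu) = m l" for l
  proof -
    have pow: "(\<lambda>z::complex. z ^ l) \<in> borel_measurable borel" by measurable
    have "char ((Q \<circ> r) j) (real l) = (\<integral>z. z ^ l \<partial>P (r j))" for j
    proof -
      have "char (Q (r j)) (real l) = (\<integral>z. iexp (real l * Arg z) \<partial>P (r j))"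
        unfolding char_def Q_def by (rule integral_distr) (auto intro: Arg_P)
      also have "\<dots> = (\<integral>z. z ^ l \<partial>P (r j))"
      proof (rule integral_cong_AE)
        have "iexp (real l * Arg z) = z ^ l" if "cmod z = 1" for z
        proof -
          have "cis (Arg z) = z" using that by (metis cis_Arg div_by_1 norm_zero of_real_1 sgn_eq zero_neq_one)
          then have "z ^ l = cis (real l * Arg z)" by (simp flip: Complex.DeMoivre)
          then show ?thesis by (simp add: cis_conv_exp)
        qed
        then show "AE z in P (r j). iexp (real l * Arg z) = z ^ l"
          using P(3)[of "r j"] by auto
        show "(\<lambda>z. z ^ l) \<in> borel_measurable (P (r j))"
          using pow measurable_cong_sets[OF P(2) refl] by blast
        show "(\<lambda>z. iexp (real l * Arg z)) \<in> borel_measurable (P (r j))"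
          using Arg_P[of "r j"] by measurable
      qed
      finally show ?thesis by simp
    qed
    moreover have "(\<lambda>j. char ((Q \<circ> r) j) (real l)) \<longlonglongrightarrow> char M (real l)"
      by (rule levy_continuity1[OF _ M conv]) (simp add: Q)
    moreover have "(\<lambda>j. \<integral>z. z ^ l \<partial>P (r j)) \<longlonglongrightarrow> m l"
      using LIMSEQ_subseq_LIMSEQ[OF lim r, of l] by (simp add: comp_def)
    ultimately have "char M (real l) = m l"
      by (simp add: LIMSEQ_unique)
    moreover have "(\<integral>z. z ^ l \<partial>nu) = (\<integral>x. cis x ^ l \<partial>M)"
      unfolding nu_def by (rule integral_distr[OF cis pow])
    moreover have "cis x ^ l = iexp (real l * x)" for x
      by (subst Complex.DeMoivre) (simp add: cis_conv_exp)
    ultimately show ?thesis by (simp add: char_def)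
  qed
  ultimately show ?thesis unfolding nu_def by auto
qed

section \<open>Right limits\<close>

theorem corollary4p7:
  fixes \<alpha> :: "nat \<Rightarrow> complex" and \<mu> :: "complex measure" and c :: complex and k :: enat
  assumes "\<And>n. cmod (\<alpha> n) < 1"
    and "spectral_measure (half_CMV \<alpha>) (delta 0) \<mu>"
    and "cmod c \<le> 1" and "c \<noteq> 0" and "k \<ge> 1"
    and "\<And>l::nat. 1 \<le> l \<Longrightarrow> enat l < k \<Longrightarrow> (\<lambda>n. \<integral>z. z ^ l \<partial>(OP_measure \<mu> n)) \<longlonglongrightarrow> 0"
    and "\<And>l::nat. k = enat l \<Longrightarrow> (\<lambda>n. \<integral>z. z ^ l \<partial>(OP_measure \<mu> n)) \<longlonglongrightarrow> c"
  shows "right_limits \<alpha> \<subseteq> (case k of enat m \<Rightarrow> K_fin c m | \<infinity> \<Rightarrow> K_inf)"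
proof
  fix E assume "E \<in> right_limits \<alpha>"
  then obtain \<beta> s where E: "E = whole_CMV \<beta>" and \<beta>: "\<And>n. cmod (\<beta> n) \<le> 1"
    and s: "filterlim s at_top sequentially" and lim: "\<And>n. (\<lambda>j. \<alpha> (nat (n + s j))) \<longlonglongrightarrow> \<beta> n"
    by (auto simp: right_limits_def)
  interpret cmv_measure \<alpha> \<mu>
    by unfold_locales (use assms(1,2) in auto)
  have E_whole: "E \<in> whole_line_CMV"
    using E \<beta> by (auto simp: whole_line_CMV_def)
  have diag_power: "(E ^^ l) (delta n) n = diag_power True \<beta> l n" for l n
    by (simp add: E whole_CMV_eq_cmv diag_power_def)
  have conv: "(\<lambda>j. \<integral>z. z ^ l \<partial>OP_measure \<mu> (nat (n + s j))) \<longlonglongrightarrow> diag_power True \<beta> l n" for l n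
    unfolding OP_measure_moment by (rule right_limit_diag_power[OF s lim])
  have idx: "filterlim (\<lambda>j. nat (n + s j)) at_top sequentially" for n
    using s unfolding filterlim_at_top
  proof (intro allI)
    fix N
    assume "\<forall>Z. \<forall>\<^sub>F x in sequentially. Z \<le> s x"
    then have "\<forall>\<^sub>F x in sequentially. int N - n \<le> s x" by blast
    then show "\<forall>\<^sub>F x in sequentially. N \<le> nat (n + s x)"
      by eventually_elim linarith
  qed
  \<comment> \<open>The indices \<open>n + s j\<close> tend to infinity for every \<open>n\<close>,
    so a limit of the full sequence of moments is attained at all diagonal positions alike.\<close>
  have diag_power_lim: "diag_power True \<beta> l n = L" if "(\<lambda>n. \<integral>z. z ^ l \<partial>OP_measure \<mu> n) \<longlonglongrightarrow> L" for l n L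
    using filterlim_compose[OF that idx] conv by (rule LIMSEQ_unique[symmetric])
  show "E \<in> (case k of enat m \<Rightarrow> K_fin c m | \<infinity> \<Rightarrow> K_inf)"
  proof (cases k)
    case infinity
    have "diag_power True \<beta> l n = 0" if "1 \<le> l" for l n
      by (rule diag_power_lim, rule assms(6)) (use that infinity in auto)
    then show ?thesis by (simp add: infinity K_inf_def E_whole diag_power)
  next
    case (enat m)
    interpret gap_moments True \<beta> m c
    proof
      show "1 \<le> m" using assms(5) enat by (simp add: one_enat_def)
      show "diag_power True \<beta> l n = 0" if "1 \<le> l" "l < m" for l n
        by (rule diag_power_lim, rule assms(6)) (use that enat in auto)
      show "diag_power True \<beta> m n = c" for n
        by (rule diag_power_lim, rule assms(7)) (use enat in auto)
    qed (rule assms(4))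
    \<comment> \<open>The limit measure is formed at coordinate 0; \<open>diag_power_const\<close>
      makes it the spectral measure of every \<open>delta n\<close>.\<close>
    obtain nu where nu: "finite_measure nu" "sets nu = sets borel" "emeasure nu (- sphere 0 1) = 0"
      "\<And>l. (\<integral>z. z ^ l \<partial>nu) = diag_power True \<beta> l 0"
      using circle_measure_limit[of "\<lambda>j. OP_measure \<mu> (nat (0 + s j))" "\<lambda>l. diag_power True \<beta> l 0"]
        prob_space_OP_measure sets_OP_measure AE_OP_measure conv[where n = 0] by blast
    have "spectral_measure E (delta n) nu" for n
      using nu diag_power_const[of _ n] by (simp add: spectral_measure_def diag_power)
    then have "E \<in> Khrushchev_class"
      using E_whole by (auto simp: Khrushchev_class_def)
    then show ?thesis
      using low top assms(4) by (simp add: enat K_fin_def diag_power)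
  qed
qed

end
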